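(* Let $\Omega\subset\mathbb{R}^n$ be a bounded open set with $|\Omega|=1$. Let $1<p<\infty$, $0<\beta<\alpha$, $0<\theta<1$ and $1\le r<\infty$. Then $$(L^{p),\alpha}(\Omega),L^{p),\beta}(\Omega))_{\theta,r}=G\Gamma(p,r;w_1,w_2),$$ with equivalent (quasi-)norms, where $w_1(t)=t^{-1}(1-\log t)^{\frac{r\theta}{p}(\alpha-\beta)-1}$ and $w_2(t)=(1-\log t)^{-\alpha}$.
   Context: $\log$ is the natural logarithm. For measurable $f:\Omega\to\mathbb{R}$, $f_*$ is the decreasing rearrangement of $|f|$ on $(0,1)$: $f_*(s)=\inf\{t\ge0:|\{x:|f(x)|>t\}|\le s\}$, and $f_*^p=(f_* )^p$. Grand Lebesgue space $L^{p),\eta}$ ($\eta>0$): measurable $f$ with $\|f\|_{p),\eta}=\sup_{0<t<1}(1-\log t)^{-\eta/p}\left(\int_t^1 f_*^p(\sigma)\,d\sigma\right)^{1/p}<\infty$. Generalized Gamma space $G\Gamma(p,m;w_1,w_2)$ ($1\le p,m<\infty$): measurable $f$ with $\left[\int_0^1 w_1(t)\left(\int_0^t f_*^p(\sigma)w_2(\sigma)\,d\sigma\right)^{m/p}dt\right]^{1/m}<\infty$, equipped with this quasinorm. For a compatible couple $(X_0,X_1)$, $K(f,t;X_0,X_1)=\inf_{f=f_0+f_1}(\|f_0\|_{X_0}+t\|f_1\|_{X_1})$, and $(X_0,X_1)_{\theta,r}$ is the set of $f\in X_0+X_1$ with $\left(\int_0^1[t^{-\theta}K(f,t;X_0,X_1)]^r\frac{dt}{t}\right)^{1/r}<\infty$,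 equipped with this norm. Equality of spaces means equality as sets with equivalent quasinorms. *)

theory Defs
  imports "HOL-Analysis.Analysis"
begin

text \<open>Real powers on the extended half-line, used only with positive exponents
  (so 0 has power 0 and infinity has power infinity).\<close>

definition epowr :: "ennreal \<Rightarrow> real \<Rightarrow> ennreal" where
  "epowr x a = (if x = \<infinity> then \<infinity> else ennreal (enn2real x powr a))"

text \<open>For \<open>f\<close> measurable on a finite measure space and \<open>s > 0\<close> the set below is
  nonempty and bounded below, so the real-valued infimum is the genuine one.\<close>

definition decr_rearr :: "'a measure \<Rightarrow> ('a \<Rightarrow> real) \<Rightarrow> real \<Rightarrow> real" where
  "decr_rearr M f s = Inf {t. 0 \<le> t \<and> emeasure M {x \<in> space M. \<bar>f x\<bar> > t} \<le> ennreal s}"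

text \<open>A function space is the set of its elements together with its (quasi-)norm.
  Elements are functions rather than classes modulo equality almost everywhere; all spaces
  and norms below are invariant under changing a function on a null set or outside
  \<open>space M\<close>.\<close>

record 'a fun_space =
  elts :: "('a \<Rightarrow> real) set"
  qnorm :: "('a \<Rightarrow> real) \<Rightarrow> ennreal"

definition fun_space_of :: "'a measure \<Rightarrow> (('a \<Rightarrow> real) \<Rightarrow> ennreal) \<Rightarrow> 'a fun_space" where
  "fun_space_of M N = \<lparr>elts = {f \<in> borel_measurable M. N f < \<infinity>}, qnorm = N\<rparr>"

definition grand_norm :: "'a measure \<Rightarrow> real \<Rightarrow> real \<Rightarrow> ('a \<Rightarrow> real) \<Rightarrow> ennreal" where
  "grand_norm M p \<eta> f =
     (SUP t\<in>{0<..<1::real}. ennreal ((1 - ln t) powr (- \<eta> / p)) *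
        epowr (\<integral>\<^sup>+\<sigma>\<in>{t<..<1}. ennreal (decr_rearr M f \<sigma> powr p) \<partial>lborel) (1 / p))"

definition grand_Lebesgue :: "'a measure \<Rightarrow> real \<Rightarrow> real \<Rightarrow> 'a fun_space" where
  "grand_Lebesgue M p \<eta> = fun_space_of M (grand_norm M p \<eta>)"

definition ggamma_norm ::
  "'a measure \<Rightarrow> real \<Rightarrow> real \<Rightarrow> (real \<Rightarrow> real) \<Rightarrow> (real \<Rightarrow> real) \<Rightarrow> ('a \<Rightarrow> real) \<Rightarrow> ennreal" where
  "ggamma_norm M p m w1 w2 f =
     epowr (\<integral>\<^sup>+t\<in>{0<..<1}. ennreal (w1 t) *
        epowr (\<integral>\<^sup>+\<sigma>\<in>{0<..<t}. ennreal (decr_rearr M f \<sigma> powr p * w2 \<sigma>) \<partial>lborel) (m / p) \<partial>lborel)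
       (1 / m)"

definition GGamma ::
  "'a measure \<Rightarrow> real \<Rightarrow> real \<Rightarrow> (real \<Rightarrow> real) \<Rightarrow> (real \<Rightarrow> real) \<Rightarrow> 'a fun_space" where
  "GGamma M p m w1 w2 = fun_space_of M (ggamma_norm M p m w1 w2)"

definition decomps ::
  "'a measure \<Rightarrow> 'a fun_space \<Rightarrow> 'a fun_space \<Rightarrow> ('a \<Rightarrow> real) \<Rightarrow> (('a \<Rightarrow> real) \<times> ('a \<Rightarrow> real)) set" where
  "decomps M X0 X1 f = {(f0, f1). f0 \<in> elts X0 \<and> f1 \<in> elts X1 \<and> (AE x in M. f x = f0 x + f1 x)}"

definition sum_elts :: "'a measure \<Rightarrow> 'a fun_space \<Rightarrow> 'a fun_space \<Rightarrow> ('a \<Rightarrow> real) set" where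
  "sum_elts M X0 X1 = {f \<in> borel_measurable M. decomps M X0 X1 f \<noteq> {}}"

definition K_functional ::
  "'a measure \<Rightarrow> 'a fun_space \<Rightarrow> 'a fun_space \<Rightarrow> ('a \<Rightarrow> real) \<Rightarrow> real \<Rightarrow> ennreal" where
  "K_functional M X0 X1 f t =
     (INF (f0, f1)\<in>decomps M X0 X1 f. qnorm X0 f0 + ennreal t * qnorm X1 f1)"

definition interp_norm ::
  "'a measure \<Rightarrow> 'a fun_space \<Rightarrow> 'a fun_space \<Rightarrow> real \<Rightarrow> real \<Rightarrow> ('a \<Rightarrow> real) \<Rightarrow> ennreal" where
  "interp_norm M X0 X1 \<theta> r f =
     epowr (\<integral>\<^sup>+t\<in>{0<..<1}. epowr (ennreal (t powr (- \<theta>)) * K_functional M X0 X1 f t) r *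
        ennreal (1 / t) \<partial>lborel) (1 / r)"

definition real_interp ::
  "'a measure \<Rightarrow> 'a fun_space \<Rightarrow> 'a fun_space \<Rightarrow> real \<Rightarrow> real \<Rightarrow> 'a fun_space" where
  "real_interp M X0 X1 \<theta> r =
     \<lparr>elts = {f \<in> sum_elts M X0 X1. interp_norm M X0 X1 \<theta> r f < \<infinity>},
      qnorm = interp_norm M X0 X1 \<theta> r\<rparr>"

definition equal_spaces :: "'a fun_space \<Rightarrow> 'a fun_space \<Rightarrow> bool" where
  "equal_spaces X Y \<longleftrightarrow> elts X = elts Y \<and>
     (\<exists>c C :: real. 0 < c \<and> 0 < C \<and>
        (\<forall>f\<in>elts X. ennreal c * qnorm X f \<le> qnorm Y f \<and> qnorm Y f \<le> ennreal C * qnorm X f))"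

end

theory Submission
  imports Defs
begin

text \<open>
  Write \<open>L t = 1 - ln t\<close>, let \<open>f\<^sub>*\<close> be the decreasing rearrangement, and cut \<open>(0,1)\<close> into the blocks on
  which \<open>L\<close> lies between \<open>2 ^ k\<close> and \<open>2 ^ (k + 1)\<close>. On a block every power of \<open>L\<close> is constant up to a
  factor, so all that matters of \<open>f\<close> is the sequence of masses \<open>a k\<close>, the integral of \<open>f\<^sub>* powr p\<close> over
  the \<open>k\<close>-th block. With \<open>c k = 2 powr ((\<theta> (\<alpha> - \<beta>) - \<alpha>) k) * a k\<close>, both norms, raised to the power
  \<open>r\<close>, are equivalent to the sum of the numbers \<open>c k powr (r / p)\<close>, called \<open>dyadic_sum\<close> below. The
  argument takes place on a finite measure space.

  For the Gamma norm, the inner integral at a point of block \<open>k\<close> is at most the tail sum of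
  \<open>2 powr (- \<alpha> j) * a j\<close> over \<open>j \<ge> k\<close> and at least a multiple of the term \<open>j = k + 1\<close>, while the
  outer weight gives block \<open>k\<close> a factor that grows geometrically in \<open>k\<close>. For the
  interpolation norm, the interval \<open>(0,1)\<close> of the parameter is cut at
  \<open>\<rho> k = 2 powr (- k (\<alpha> - \<beta>) / p)\<close>, so that the \<open>k\<close>-th piece belongs to block \<open>k\<close>.

  The lower bound for the K-functional (\<open>K_ge_mass\<close>) uses only
  \<open>f\<^sub>* s \<le> f0\<^sub>* (s / 2) + f1\<^sub>* (s / 2)\<close>: halving the argument moves a point by at most one block. The upper
  bound (\<open>K_le_smoothed\<close>) comes from truncating \<open>f\<close> at the height \<open>f\<^sub>*\<close> takes at the right end of
  block \<open>k\<close>. It produces the tail sum above plus the head sum of \<open>2 powr (- \<beta> j) * a j\<close> over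
  \<open>j \<le> k\<close>, with a factor \<open>2 powr (- (\<alpha> - \<beta>) k)\<close>. Since \<open>0 < \<theta> < 1\<close>, after normalisation both sums
  are dominated by one convolution of \<open>c\<close> with a two-sided geometric kernel, and a discrete Hardy
  inequality (\<open>discrete_hardy\<close>) shows that such a convolution does not increase the sum of
  \<open>(r / p)\<close>-th powers by more than a constant factor.
\<close>


section \<open>Powers of extended nonnegative reals\<close>

lemma epowr_ennreal: "0 \<le> x \<Longrightarrow> epowr (ennreal x) a = ennreal (x powr a)"
  by (simp add: epowr_def)

lemma epowr_top: "epowr top a = top"
  by (simp add: epowr_def)

lemma epowr_zero: "epowr 0 a = 0"
  by (simp add: epowr_def)

lemma epowr_one: "epowr x 1 = x"
  by (cases x) (simp_all add: epowr_ennreal epowr_top)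

lemma epowr_mono: "0 \<le> a \<Longrightarrow> x \<le> y \<Longrightarrow> epowr x a \<le> epowr y a"
  by (cases x; cases y) (auto simp: epowr_ennreal epowr_top top_unique intro!: ennreal_leI powr_mono2)

lemma epowr_less_top_iff: "epowr x a < top \<longleftrightarrow> x < top"
  by (cases x) (simp_all add: epowr_ennreal epowr_top)

lemma epowr_mult: "epowr (x * y) a = epowr x a * epowr y a"
proof (cases x)
  case x: (real u)
  show ?thesis
  proof (cases y)
    case (real v)
    then show ?thesis using x
      by (simp add: epowr_ennreal powr_mult flip: ennreal_mult)
  next
    case top
    then show ?thesis using x
      by (cases "u = 0") (auto simp: epowr_ennreal epowr_top epowr_zero ennreal_mult_top)
  qed
next
  case x: top
  show ?thesis
  proof (cases y)
    case (real v)
    then show ?thesis using x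
      by (cases "v = 0") (auto simp: epowr_ennreal epowr_top epowr_zero ennreal_top_mult)
  next
    case top
    then show ?thesis using x by (simp add: epowr_top)
  qed
qed

lemma epowr_epowr: "epowr (epowr x a) b = epowr x (a * b)"
  by (cases x) (simp_all add: epowr_ennreal epowr_top powr_powr)

lemma epowr_cancel: "a \<noteq> 0 \<Longrightarrow> epowr (epowr x (1 / a)) a = x" "a \<noteq> 0 \<Longrightarrow> epowr (epowr x a) (1 / a) = x"
  by (simp_all add: epowr_epowr epowr_one)

text \<open>The sum is at most twice the maximum. The constant is not sharp, but this form covers concave and
  convex powers at once.\<close>

lemma epowr_add_le:
  assumes "0 \<le> a"
  shows "epowr (x + y) a \<le> ennreal (2 powr a) * (epowr x a + epowr y a)"
proof -
  have "epowr (x + y) a \<le> epowr (ennreal 2 * max x y) a"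
    using assms add_mono[OF max.cobounded1[of x y] max.cobounded2[of y x]]
    by (intro epowr_mono) (simp_all add: mult_2)
  also have "\<dots> = ennreal (2 powr a) * epowr (max x y) a"
    using epowr_ennreal[of 2 a] by (simp add: epowr_mult)
  also have "epowr (max x y) a \<le> epowr x a + epowr y a"
    by (simp add: max_def)
  finally show ?thesis by (simp add: mult_left_mono)
qed

section \<open>A discrete Hardy inequality\<close>

lemma two_sided_geometric_sums:
  fixes x :: real
  assumes "0 \<le> x" "x < 1"
  shows "(\<lambda>j. x ^ ((j - k) + (k - j))) sums ((1 + x - x ^ (k + 1)) / (1 - x))"
proof (induction k)
  case 0
  show ?case using geometric_sums[of x] assms by simp
next
  case (Suc k)
  have "(\<lambda>j. x ^ ((Suc j - Suc k) + (Suc k - Suc j))) sums ((1 + x - x ^ (k + 1)) / (1 - x))"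
    using Suc by simp
  then have "(\<lambda>j. x ^ ((j - Suc k) + (Suc k - j))) sums ((1 + x - x ^ (k + 1)) / (1 - x) + x ^ Suc k)"
    by (subst (asm) sums_Suc_iff) simp
  moreover have "(1 + x - x ^ (k + 1)) / (1 - x) + x ^ Suc k = (1 + x - x ^ (Suc k + 1)) / (1 - x)"
    using assms by (simp add: field_simps)
  ultimately show ?case by (simp only:)
qed

lemma two_sided_geometric_le:
  fixes x :: real
  assumes "0 \<le> x" "x < 1"
  shows "(\<Sum>j. ennreal (x ^ ((j - k) + (k - j)))) \<le> ennreal (2 / (1 - x))"
proof -
  have "(\<Sum>j. ennreal (x ^ ((j - k) + (k - j)))) = ennreal ((1 + x - x ^ (k + 1)) / (1 - x))"
    using two_sided_geometric_sums[OF assms, of k] assms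
    by (intro suminf_ennreal_eq) auto
  also have "\<dots> \<le> ennreal (2 / (1 - x))"
  proof (intro ennreal_leI divide_right_mono)
    show "1 + x - x ^ (k + 1) \<le> 2" using assms zero_le_power[of x "k + 1"] by linarith
  qed (use assms in simp)
  finally show ?thesis .
qed

lemma suminf_swap_ennreal:
  fixes f :: "nat \<Rightarrow> nat \<Rightarrow> ennreal"
  shows "(\<Sum>i. \<Sum>j. f i j) = (\<Sum>j. \<Sum>i. f i j)"
proof -
  have "(\<Sum>i. \<Sum>j. f i j) = (\<integral>\<^sup>+i. (\<Sum>j. f i j) \<partial>count_space UNIV)"
    by (simp add: nn_integral_count_space_nat)
  also have "\<dots> = (\<Sum>j. \<integral>\<^sup>+i. f i j \<partial>count_space UNIV)"
    by (rule nn_integral_suminf) simp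
  finally show ?thesis by (simp add: nn_integral_count_space_nat)
qed

lemma term_le_suminf_ennreal:
  fixes f :: "nat \<Rightarrow> ennreal"
  shows "f k \<le> (\<Sum>i. f i)"
  using sum_le_suminf[of f "{k}"] by simp

text \<open>Split the kernel as \<open>x ^ d = y ^ d * y ^ d\<close> with \<open>y = sqrt x\<close>. One factor \<open>y ^ d\<close> stays with
  \<open>c j\<close>, and each product \<open>y ^ d * c j\<close> is bounded by the \<open>q\<close>-norm of the whole sequence of such
  products; the other factor is summed as a geometric series. The \<open>q\<close>-th power of the bound is again
  a convolution with a geometric kernel, now of ratio \<open>y powr q\<close>, and is linear in \<open>c j powr q\<close>, so
  exchanging the sums finishes the proof. This treats exponents on both sides of \<open>1\<close> alike, as is
  required for \<open>q = r / p\<close>.\<close>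

lemma discrete_hardy:
  fixes x q :: real
  assumes "0 < x" "x < 1" "0 < q"
  obtains C :: real where "0 < C"
    "\<And>c :: nat \<Rightarrow> ennreal. (\<Sum>k. epowr (\<Sum>j. ennreal (x ^ ((j - k) + (k - j))) * c j) q) \<le> ennreal C * (\<Sum>j. epowr (c j) q)"
proof -
  define y where "y = sqrt x"
  define z where "z = y powr q"
  have y: "0 < y" "y < 1" "x = y * y" using assms by (auto simp: y_def)
  have z: "0 < z" "z < 1" using y(1,2) assms(3) powr_less_mono2[of q y 1] by (auto simp: z_def)
  have y_powr: "(y ^ n) powr q = z ^ n" for n
    unfolding z_def powr_realpow[OF y(1), symmetric] powr_power
    using y(1) by (simp add: powr_powr powr_power mult.commute)
  define A where "A = 2 / (1 - y)"
  define B where "B = 2 / (1 - z)"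
  have A: "0 < A" and B: "0 < B" using y(2) z(2) by (simp_all add: A_def B_def)
  show thesis
  proof (rule that[of "A powr q * B"])
    show "0 < A powr q * B" using A B by simp
    fix c :: "nat \<Rightarrow> ennreal"
    define d where "d j k = (j - k) + (k - j)" for j k :: nat
    have d_sym: "d j k = d k j" for j k unfolding d_def by (rule add.commute)
    \<comment> \<open>The q-th power of the q-norm of the products y ^ d j k * c j.\<close>
    define S where "S k = (\<Sum>j. ennreal (z ^ d j k) * epowr (c j) q)" for k
    have "epowr (\<Sum>j. ennreal (x ^ d j k) * c j) q \<le> ennreal (A powr q) * S k" for k
    proof -
      have term_le: "ennreal (y ^ d j k) * c j \<le> epowr (S k) (1 / q)" for j
      proof -
        have "epowr (ennreal (y ^ d j k) * c j) q = ennreal (z ^ d j k) * epowr (c j) q"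
          using y(1) y_powr[of "d j k"] by (simp add: epowr_mult epowr_ennreal)
        also have "\<dots> \<le> S k" unfolding S_def by (rule term_le_suminf_ennreal)
        finally have "epowr (epowr (ennreal (y ^ d j k) * c j) q) (1 / q) \<le> epowr (S k) (1 / q)"
          using assms by (intro epowr_mono) auto
        then show ?thesis using assms by (simp add: epowr_cancel)
      qed
      have "(\<Sum>j. ennreal (x ^ d j k) * c j) = (\<Sum>j. ennreal (y ^ d j k) * (ennreal (y ^ d j k) * c j))"
        using y(1) unfolding y(3) by (simp add: power_mult_distrib ennreal_mult mult.assoc)
      also have "\<dots> \<le> (\<Sum>j. ennreal (y ^ d j k) * epowr (S k) (1 / q))"
        by (intro suminf_le mult_left_mono term_le) auto
      also have "\<dots> = (\<Sum>j. ennreal (y ^ d j k)) * epowr (S k) (1 / q)"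
        by (rule ennreal_suminf_multc)
      also have "\<dots> \<le> ennreal A * epowr (S k) (1 / q)"
        unfolding A_def d_def by (rule mult_right_mono[OF two_sided_geometric_le]) (use y(1,2) in simp_all)
      finally have "epowr (\<Sum>j. ennreal (x ^ d j k) * c j) q \<le> epowr (ennreal A * epowr (S k) (1 / q)) q"
        using assms by (intro epowr_mono) auto
      also have "\<dots> = ennreal (A powr q) * S k"
        using assms A by (simp add: epowr_mult epowr_ennreal epowr_cancel)
      finally show ?thesis .
    qed
    then have "(\<Sum>k. epowr (\<Sum>j. ennreal (x ^ d j k) * c j) q) \<le> (\<Sum>k. ennreal (A powr q) * S k)"
      by (intro suminf_le) auto
    also have "\<dots> = ennreal (A powr q) * (\<Sum>j. \<Sum>k. ennreal (z ^ d j k) * epowr (c j) q)"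
      unfolding S_def ennreal_suminf_cmult by (subst suminf_swap_ennreal) simp
    also have "\<dots> = ennreal (A powr q) * (\<Sum>j. (\<Sum>k. ennreal (z ^ d k j)) * epowr (c j) q)"
      by (simp add: d_sym)
    also have "\<dots> \<le> ennreal (A powr q) * (\<Sum>j. ennreal B * epowr (c j) q)"
      unfolding B_def d_def
      by (intro mult_left_mono suminf_le mult_right_mono two_sided_geometric_le) (use z in simp_all)
    also have "\<dots> = ennreal (A powr q * B) * (\<Sum>j. epowr (c j) q)"
      using B by (simp add: ennreal_mult mult.assoc)
    finally show "(\<Sum>k. epowr (\<Sum>j. ennreal (x ^ ((j - k) + (k - j))) * c j) q) \<le> ennreal (A powr q * B) * (\<Sum>j. epowr (c j) q)"
      by (simp add: d_def)
  qed
qed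

section \<open>The decreasing rearrangement\<close>

lemma decr_rearr_le:
  assumes "0 \<le> t" "emeasure M {x \<in> space M. \<bar>f x\<bar> > t} \<le> ennreal s"
  shows "decr_rearr M f s \<le> t"
  unfolding decr_rearr_def using assms by (intro cInf_lower bdd_belowI[where m = 0]) simp_all

text \<open>Finiteness of the measure makes the set of admissible heights nonempty, because the superlevel
  sets \<open>{\<bar>f\<bar> > n}\<close> decrease to the empty set; continuity from below makes the infimum admissible.\<close>

lemma decr_rearr_attained:
  assumes "finite_measure M" and [measurable]: "f \<in> borel_measurable M" and "0 < s"
  shows decr_rearr_nonneg: "0 \<le> decr_rearr M f s"
    and emeasure_gt_decr_rearr: "emeasure M {x \<in> space M. \<bar>f x\<bar> > decr_rearr M f s} \<le> ennreal s"
proof -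
  interpret finite_measure M by fact
  define T where "T = {t. 0 \<le> t \<and> emeasure M {x \<in> space M. \<bar>f x\<bar> > t} \<le> ennreal s}"
  have eq: "decr_rearr M f s = Inf T" by (simp add: decr_rearr_def T_def)
  have bdd: "bdd_below T" by (auto simp: T_def)
  have "(\<lambda>n. emeasure M {x \<in> space M. \<bar>f x\<bar> > real n}) \<longlonglongrightarrow> emeasure M (\<Inter>n. {x \<in> space M. \<bar>f x\<bar> > real n})"
    by (intro Lim_emeasure_decseq) (auto simp: decseq_def)
  moreover have "(\<Inter>n. {x \<in> space M. \<bar>f x\<bar> > real n}) = {}"
  proof -
    have "\<exists>n. \<not> real n < \<bar>f x\<bar>" for x using real_arch_simple[of "\<bar>f x\<bar>"] by (auto simp: not_less)
    then show ?thesis by auto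
  qed
  ultimately have "(\<lambda>n. emeasure M {x \<in> space M. \<bar>f x\<bar> > real n}) \<longlonglongrightarrow> 0" by (simp only: emeasure_empty)
  then have "eventually (\<lambda>n. emeasure M {x \<in> space M. \<bar>f x\<bar> > real n} < ennreal s) sequentially"
    using assms(3) by (intro order_tendstoD) auto
  then obtain n where "emeasure M {x \<in> space M. \<bar>f x\<bar> > real n} < ennreal s"
    by (auto simp: eventually_sequentially)
  then have ne: "T \<noteq> {}" by (auto simp: T_def intro!: exI[of _ "real n"])
  then show nonneg: "0 \<le> decr_rearr M f s"
    unfolding eq by (rule cInf_greatest) (simp add: T_def)
  define A where "A n = {x \<in> space M. \<bar>f x\<bar> > decr_rearr M f s + 1 / real (Suc n)}" for n
  have A_le: "emeasure M (A n) \<le> ennreal s" for n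
  proof -
    have "Inf T < decr_rearr M f s + 1 / real (Suc n)" by (simp add: eq)
    then obtain t where t: "t \<in> T" "t < decr_rearr M f s + 1 / real (Suc n)"
      using ne bdd by (auto simp: cInf_less_iff)
    have "emeasure M (A n) \<le> emeasure M {x \<in> space M. \<bar>f x\<bar> > t}"
      using t by (intro emeasure_mono) (auto simp: A_def)
    with t show ?thesis by (auto simp: T_def)
  qed
  have [measurable]: "A n \<in> sets M" for n unfolding A_def by measurable
  have "incseq A"
    by (auto simp: incseq_def A_def intro: le_less_trans[rotated] intro!: add_left_mono frac_le)
  then have "emeasure M (\<Union>n. A n) = (SUP n. emeasure M (A n))"
    by (intro SUP_emeasure_incseq[symmetric]) auto
  also have "\<dots> \<le> ennreal s" by (intro SUP_least A_le)
  also have "(\<Union>n. A n) = {x \<in> space M. \<bar>f x\<bar> > decr_rearr M f s}"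
  proof -
    have "\<exists>n. decr_rearr M f s + 1 / real (Suc n) < \<bar>f x\<bar>" if "decr_rearr M f s < \<bar>f x\<bar>" for x
      using reals_Archimedean[of "\<bar>f x\<bar> - decr_rearr M f s"] that by (auto simp: field_simps)
    moreover have "decr_rearr M f s < \<bar>f x\<bar>" if "decr_rearr M f s + 1 / real (Suc n) < \<bar>f x\<bar>" for n x
    proof -
      have "0 < 1 / real (Suc n)" by simp
      with that show ?thesis by linarith
    qed
    ultimately show ?thesis unfolding A_def by blast
  qed
  finally show "emeasure M {x \<in> space M. \<bar>f x\<bar> > decr_rearr M f s} \<le> ennreal s" .
qed

lemma decr_rearr_antimono:
  assumes "finite_measure M" "f \<in> borel_measurable M" "0 < s" "s \<le> s'"
  shows "decr_rearr M f s' \<le> decr_rearr M f s"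
  using decr_rearr_attained[OF assms(1-3)] assms(4)
  by (intro decr_rearr_le) (auto intro: order_trans ennreal_leI)

lemma decr_rearr_mono:
  assumes "finite_measure M" "f \<in> borel_measurable M" "0 < s" "\<And>x. \<bar>g x\<bar> \<le> \<bar>f x\<bar>"
  shows "decr_rearr M g s \<le> decr_rearr M f s"
proof (rule decr_rearr_le)
  note [measurable] = assms(2)
  have "emeasure M {x \<in> space M. \<bar>g x\<bar> > decr_rearr M f s} \<le> emeasure M {x \<in> space M. \<bar>f x\<bar> > decr_rearr M f s}"
    using assms(4) by (intro emeasure_mono) (auto intro: less_le_trans)
  then show "emeasure M {x \<in> space M. \<bar>g x\<bar> > decr_rearr M f s} \<le> ennreal s"
    using decr_rearr_attained(2)[OF assms(1-3)] by (rule order_trans)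
qed (rule decr_rearr_attained(1)[OF assms(1-3)])

lemma decr_rearr_add:
  assumes "finite_measure M" and [measurable]: "f0 \<in> borel_measurable M" "f1 \<in> borel_measurable M"
    and "0 < s" and "AE x in M. f x = f0 x + f1 x"
  shows "decr_rearr M f s \<le> decr_rearr M f0 (s / 2) + decr_rearr M f1 (s / 2)"
proof (rule decr_rearr_le)
  let ?v = "decr_rearr M f0 (s / 2)" and ?w = "decr_rearr M f1 (s / 2)"
  let ?A = "{x \<in> space M. \<bar>f0 x\<bar> > ?v}" and ?B = "{x \<in> space M. \<bar>f1 x\<bar> > ?w}"
  have s: "0 < s / 2" using assms by simp
  show "0 \<le> ?v + ?w"
    using decr_rearr_nonneg[OF assms(1,2) s] decr_rearr_nonneg[OF assms(1,3) s] by simp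
  have "AE x in M. x \<in> {x \<in> space M. \<bar>f x\<bar> > ?v + ?w} \<longrightarrow> x \<in> ?A \<union> ?B"
    using assms(5) by eventually_elim (auto simp: abs_if split: if_splits)
  then have "emeasure M {x \<in> space M. \<bar>f x\<bar> > ?v + ?w} \<le> emeasure M (?A \<union> ?B)"
    by (rule emeasure_mono_AE) measurable
  also have "\<dots> \<le> emeasure M ?A + emeasure M ?B"
    by (rule emeasure_subadditive) measurable
  also have "\<dots> \<le> ennreal (s / 2) + ennreal (s / 2)"
    by (intro add_mono emeasure_gt_decr_rearr assms(1-3) s)
  also have "\<dots> = ennreal s" using assms(4) by (subst ennreal_plus[symmetric]) auto
  finally show "emeasure M {x \<in> space M. \<bar>f x\<bar> > ?v + ?w} \<le> ennreal s" .
qed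

text \<open>On the nonpositive half-line the rearrangement is constant, because \<open>ennreal\<close> maps it to \<open>0\<close>;
  on the positive one it is monotone.\<close>

lemma decr_rearr_measurable:
  assumes "finite_measure M" "f \<in> borel_measurable M"
  shows "decr_rearr M f \<in> borel_measurable borel"
proof -
  have "(\<lambda>s. - decr_rearr M f s) \<in> borel_measurable borel"
  proof (rule borel_measurable_piecewise_mono[of "{{..0}, {0<..}}"])
    fix c :: "real set" assume "c \<in> {{..0}, {0<..}}"
    then show "mono_on c (\<lambda>s. - decr_rearr M f s)"
      using decr_rearr_antimono[OF assms] by (auto simp: mono_on_def decr_rearr_def ennreal_neg)
  qed auto
  then show ?thesis by simp
qed

section \<open>Integrals over countable partitions\<close>

text \<open>The integrand \<open>g\<close> is compared block by block with a measurable \<open>h\<close>, since \<open>g\<close> will involve a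
  K-functional, an infimum over an uncountable family.\<close>

lemma nn_integral_UN_le:
  fixes J :: "nat \<Rightarrow> real set" and g h :: "real \<Rightarrow> ennreal" and b :: "nat \<Rightarrow> ennreal"
  assumes [measurable]: "\<And>k. J k \<in> sets borel" "h \<in> borel_measurable borel"
    and le: "\<And>k x. x \<in> J k \<Longrightarrow> g x \<le> b k * h x"
  shows "(\<integral>\<^sup>+x\<in>(\<Union>k. J k). g x \<partial>lborel) \<le> (\<Sum>k. b k * (\<integral>\<^sup>+x\<in>J k. h x \<partial>lborel))"
proof -
  have "(\<integral>\<^sup>+x\<in>(\<Union>k. J k). g x \<partial>lborel) \<le> (\<integral>\<^sup>+x. (\<Sum>k. b k * (h x * indicator (J k) x)) \<partial>lborel)"
  proof (rule nn_integral_mono)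
    fix x :: real
    show "g x * indicator (\<Union>k. J k) x \<le> (\<Sum>k. b k * (h x * indicator (J k) x))"
    proof (cases "x \<in> (\<Union>k. J k)")
      case True
      then obtain m where m: "x \<in> J m" by auto
      have "g x * indicator (\<Union>k. J k) x \<le> b m * (h x * indicator (J m) x)"
        using le[OF m] m True by simp
      also have "\<dots> \<le> (\<Sum>k. b k * (h x * indicator (J k) x))"
        by (rule term_le_suminf_ennreal)
      finally show ?thesis .
    qed simp
  qed
  also have "\<dots> = (\<Sum>k. \<integral>\<^sup>+x. b k * (h x * indicator (J k) x) \<partial>lborel)"
    by (rule nn_integral_suminf) measurable
  also have "\<dots> = (\<Sum>k. b k * (\<integral>\<^sup>+x\<in>J k. h x \<partial>lborel))"
    by (simp add: nn_integral_cmult)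
  finally show ?thesis .
qed

lemma nn_integral_UN_ge:
  fixes J :: "nat \<Rightarrow> real set" and g h :: "real \<Rightarrow> ennreal" and b :: "nat \<Rightarrow> ennreal"
  assumes disj: "disjoint_family J" and [measurable]: "\<And>k. J k \<in> sets borel" "h \<in> borel_measurable borel"
    and ge: "\<And>k x. x \<in> J k \<Longrightarrow> b k * h x \<le> g x"
  shows "(\<Sum>k. b k * (\<integral>\<^sup>+x\<in>J k. h x \<partial>lborel)) \<le> (\<integral>\<^sup>+x\<in>(\<Union>k. J k). g x \<partial>lborel)"
proof -
  have "(\<Sum>k. b k * (\<integral>\<^sup>+x\<in>J k. h x \<partial>lborel)) = (\<Sum>k. \<integral>\<^sup>+x. b k * (h x * indicator (J k) x) \<partial>lborel)"
    by (simp add: nn_integral_cmult)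
  also have "\<dots> = (\<integral>\<^sup>+x. (\<Sum>k. b k * (h x * indicator (J k) x)) \<partial>lborel)"
    by (rule nn_integral_suminf[symmetric]) measurable
  also have "\<dots> \<le> (\<integral>\<^sup>+x\<in>(\<Union>k. J k). g x \<partial>lborel)"
  proof (rule nn_integral_mono)
    fix x :: real
    show "(\<Sum>k. b k * (h x * indicator (J k) x)) \<le> g x * indicator (\<Union>k. J k) x"
    proof (cases "x \<in> (\<Union>k. J k)")
      case True
      then obtain m where m: "x \<in> J m" by auto
      have "(\<Sum>k. b k * (h x * indicator (J k) x)) = b m * h x"
        using suminf_cmult_indicator[OF disj m, of "\<lambda>k. b k * h x"] by (simp add: mult.assoc)
      then show ?thesis using ge[OF m] True by simp
    qed simp
  qed
  finally show ?thesis .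
qed

lemma UN_intervals_decseq:
  fixes a :: "nat \<Rightarrow> real"
  assumes "decseq a" "a \<longlonglongrightarrow> l"  "\<And>k. l < a k"
  shows "(\<Union>k. {a (Suc k)..<a k}) = {l<..<a 0}"
proof (intro equalityI subsetI)
  fix x assume "x \<in> (\<Union>k. {a (Suc k)..<a k})"
  then obtain k where "a (Suc k) \<le> x" "x < a k" by auto
  with assms(3)[of "Suc k"] decseqD[OF assms(1), of 0 k] show "x \<in> {l<..<a 0}" by auto
next
  fix x assume x: "x \<in> {l<..<a 0}"
  then have "eventually (\<lambda>n. a n < x) sequentially"
    using assms(2) by (intro order_tendstoD) auto
  then have ex: "\<exists>n. a n \<le> x" by (auto simp: eventually_sequentially intro: less_imp_le)
  define n where "n = (LEAST n. a n \<le> x)"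
  have n: "a n \<le> x" unfolding n_def using ex by (rule LeastI_ex)
  with x obtain m where m: "n = Suc m" by (cases n) auto
  then have "\<not> a m \<le> x" using not_less_Least[of m "\<lambda>n. a n \<le> x"] by (simp add: n_def)
  with n m show "x \<in> (\<Union>k. {a (Suc k)..<a k})" by (auto simp: not_le)
qed

lemma disjoint_intervals_decseq:
  fixes a :: "nat \<Rightarrow> real"
  assumes "decseq a"
  shows "disjoint_family (\<lambda>k. {a (Suc k)..<a k})"
proof -
  have "{a (Suc m)..<a m} \<inter> {a (Suc n)..<a n} = {}" if "m < n" for m n
    using decseqD[OF assms, of "Suc m" n] that by auto
  then have "{a (Suc m)..<a m} \<inter> {a (Suc n)..<a n} = {}" if "m \<noteq> n" for m n
    using that by (metis Int_commute linorder_neqE_nat)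
  then show ?thesis by (auto simp: disjoint_family_on_def)
qed

lemma nn_integral_reciprocal:
  fixes a b :: real
  assumes "0 < a" "a \<le> b"
  shows "(\<integral>\<^sup>+x\<in>{a..<b}. ennreal (1 / x) \<partial>lborel) = ennreal (ln b - ln a)"
proof -
  have "(\<integral>\<^sup>+x\<in>{a..<b}. ennreal (1 / x) \<partial>lborel) = (\<integral>\<^sup>+x\<in>{a..b}. ennreal (1 / x) \<partial>lborel)"
    using AE_lborel_singleton[of b] by (intro nn_integral_cong_AE) (auto simp: indicator_def elim!: eventually_mono)
  also have "\<dots> = ennreal (ln b - ln a)"
    using assms by (intro nn_integral_FTC_Icc) (auto intro!: derivative_eq_intros simp: has_real_derivative_iff_has_vector_derivative[symmetric] field_simps)
  finally show ?thesis .
qed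

section \<open>Logarithmic blocks of the unit interval\<close>

text \<open>The knots are the points where \<open>1 - ln t\<close> equals \<open>2 ^ k\<close>; they decrease doubly exponentially.\<close>

definition knot :: "nat \<Rightarrow> real" where
  "knot k = exp (1 - 2 ^ k)"

abbreviation block :: "nat \<Rightarrow> real set" where
  "block k \<equiv> {knot (Suc k)..<knot k}"

lemma knot_pos: "0 < knot k" by (simp add: knot_def)

lemma knot_zero: "knot 0 = 1" by (simp add: knot_def)

lemma ln_knot: "1 - ln (knot k) = 2 ^ k" by (simp add: knot_def)

text \<open>The ratio of consecutive knots is at most \<open>1 / e\<close>. This room of a factor \<open>2\<close> is used twice:
  halving a point of a block does not lead beyond the next block, and a block carries at least half of the
  length of \<open>(0, knot k)\<close>.\<close>

lemma two_knot_Suc_less: "2 * knot (Suc k) < knot k"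
proof -
  have "(3 / 2 :: real) * (3 / 2) \<le> exp (1 / 2) * exp (1 / 2)"
    using exp_ge_add_one_self[of "1 / 2 :: real"] by (intro mult_mono) auto
  then have "(2::real) < exp 1" by (simp flip: exp_add)
  also have "\<dots> \<le> exp (2 ^ k)" by simp
  finally have "2 * knot (Suc k) < exp (2 ^ k) * knot (Suc k)"
    using knot_pos[of "Suc k"] by (intro mult_strict_right_mono) auto
  also have "\<dots> = knot k" by (simp add: knot_def flip: exp_add)
  finally show ?thesis .
qed

lemma decseq_knot: "decseq knot"
  by (auto simp: decseq_def knot_def)

lemma knot_tendsto_0: "knot \<longlonglongrightarrow> 0"
proof (rule tendsto_sandwich[of "\<lambda>_. 0" _ _ "\<lambda>k. (1 / 2) ^ k"])
  have "knot k \<le> (1 / 2) ^ k" for k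
  proof (induction k)
    case (Suc k)
    then show ?case using two_knot_Suc_less[of k] by simp
  qed (simp add: knot_zero)
  then show "\<forall>\<^sub>F k in sequentially. knot k \<le> (1 / 2) ^ k" by simp
  show "(\<lambda>k. (1 / 2) ^ k :: real) \<longlonglongrightarrow> 0" by (rule LIMSEQ_realpow_zero) auto
qed (auto simp: knot_pos less_imp_le)

lemma UN_block: "(\<Union>k. block k) = {0<..<1}"
  using UN_intervals_decseq[OF decseq_knot knot_tendsto_0 knot_pos] by (simp add: knot_zero)

lemma disjoint_block: "disjoint_family block"
  by (rule disjoint_intervals_decseq[OF decseq_knot])

lemma block_log_bounds:
  assumes "t \<in> block k"
  shows "2 ^ k \<le> 1 - ln t" "1 - ln t \<le> 2 ^ Suc k" "0 < t"
proof -
  show t: "0 < t" using assms knot_pos[of "Suc k"] by auto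
  have "ln t \<le> ln (knot k)" "ln (knot (Suc k)) \<le> ln t"
    using assms t knot_pos[of "Suc k"] by (auto intro: ln_mono)
  then show "2 ^ k \<le> 1 - ln t" "1 - ln t \<le> 2 ^ Suc k"
    using ln_knot[of k] ln_knot[of "Suc k"] by linarith+
qed

text \<open>The length of a block measured by \<open>dt / t\<close>, the measure in which the outer weight of the Gamma
  norm is a power of \<open>1 - ln t\<close>.\<close>

lemma nn_integral_reciprocal_block:
  "(\<integral>\<^sup>+x\<in>block k. ennreal (1 / x) \<partial>lborel) = ennreal (2 ^ k)"
proof -
  have "ln (knot k) - ln (knot (Suc k)) = 2 ^ k" by (simp add: knot_def)
  moreover have "knot (Suc k) \<le> knot k" by (rule decseqD[OF decseq_knot]) simp
  ultimately show ?thesis using nn_integral_reciprocal[of "knot (Suc k)" "knot k"] by (simp add: knot_pos)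
qed

section \<open>Grand norms and masses of blocks\<close>

lemma nn_integral_le_grand_norm:
  assumes "0 < p" "0 < t" "t < 1"
  shows "(\<integral>\<^sup>+\<sigma>\<in>{t<..<1}. ennreal (decr_rearr M f \<sigma> powr p) \<partial>lborel)
    \<le> ennreal ((1 - ln t) powr \<eta>) * epowr (grand_norm M p \<eta> f) p" (is "?I \<le> _")
proof -
  have L: "0 < 1 - ln t" using assms by (smt (verit) ln_less_zero)
  have "ennreal ((1 - ln t) powr (- \<eta> / p)) * epowr ?I (1 / p) \<le> grand_norm M p \<eta> f"
    unfolding grand_norm_def using assms by (intro SUP_upper) auto
  then have "epowr (ennreal ((1 - ln t) powr (- \<eta> / p)) * epowr ?I (1 / p)) p \<le> epowr (grand_norm M p \<eta> f) p"
    using assms by (intro epowr_mono) auto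
  also have "epowr (ennreal ((1 - ln t) powr (- \<eta> / p)) * epowr ?I (1 / p)) p = ennreal ((1 - ln t) powr (- \<eta>)) * ?I"
    using assms by (simp add: epowr_mult epowr_cancel epowr_ennreal powr_powr)
  finally have "ennreal ((1 - ln t) powr \<eta>) * (ennreal ((1 - ln t) powr (- \<eta>)) * ?I)
      \<le> ennreal ((1 - ln t) powr \<eta>) * epowr (grand_norm M p \<eta> f) p"
    by (rule mult_left_mono) simp
  moreover have "ennreal ((1 - ln t) powr \<eta>) * (ennreal ((1 - ln t) powr (- \<eta>)) * ?I) = ?I"
  proof -
    have "(1 - ln t) powr \<eta> * (1 - ln t) powr (- \<eta>) = 1" using L by (simp add: powr_minus)
    then show ?thesis
      by (simp add: mult.assoc[symmetric] ennreal_mult[symmetric])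
  qed
  ultimately show ?thesis by simp
qed

text \<open>For \<open>t < \<sigma>\<close> the weight at \<open>t\<close> is at most the weight at \<open>\<sigma>\<close>, so it can be moved inside the integral
  and the supremum disappears. The resulting bound is larger than the grand norm in general, but on
  the discretised level the loss is absorbed by the Hardy inequality.\<close>

lemma grand_norm_powr_le:
  assumes "finite_measure M" "f \<in> borel_measurable M" "0 < p" "0 \<le> \<eta>"
  shows "epowr (grand_norm M p \<eta> f) p
    \<le> (\<integral>\<^sup>+\<sigma>\<in>{0<..<1}. ennreal (decr_rearr M f \<sigma> powr p * (1 - ln \<sigma>) powr (- \<eta>)) \<partial>lborel)" (is "_ \<le> ?I")
proof -
  note [measurable] = decr_rearr_measurable[OF assms(1,2)]
  have "grand_norm M p \<eta> f \<le> epowr ?I (1 / p)"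
    unfolding grand_norm_def
  proof (rule SUP_least)
    fix t :: real assume t: "t \<in> {0<..<1}"
    let ?J = "\<integral>\<^sup>+\<sigma>\<in>{t<..<1}. ennreal (decr_rearr M f \<sigma> powr p) \<partial>lborel"
    have "ennreal ((1 - ln t) powr (- \<eta>)) * ?J
        = (\<integral>\<^sup>+\<sigma>\<in>{t<..<1}. ennreal ((1 - ln t) powr (- \<eta>)) * ennreal (decr_rearr M f \<sigma> powr p) \<partial>lborel)"
      by (subst nn_integral_cmult[symmetric]) (simp_all add: mult.assoc)
    also have "\<dots> \<le> ?I"
    proof (rule nn_integral_mono)
      fix \<sigma> :: real
      show "ennreal ((1 - ln t) powr (- \<eta>)) * ennreal (decr_rearr M f \<sigma> powr p) * indicator {t<..<1} \<sigma>
        \<le> ennreal (decr_rearr M f \<sigma> powr p * (1 - ln \<sigma>) powr (- \<eta>)) * indicator {0<..<1} \<sigma>"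
      proof (cases "\<sigma> \<in> {t<..<1}")
        case True
        then have "0 < 1 - ln \<sigma>" "1 - ln \<sigma> \<le> 1 - ln t"
          using t by (auto intro!: ln_mono) (smt (verit) ln_less_zero)
        then have "(1 - ln t) powr (- \<eta>) \<le> (1 - ln \<sigma>) powr (- \<eta>)"
          using assms by (intro powr_mono2') auto
        then have "(1 - ln t) powr (- \<eta>) * decr_rearr M f \<sigma> powr p \<le> decr_rearr M f \<sigma> powr p * (1 - ln \<sigma>) powr (- \<eta>)"
          by (subst mult.commute) (intro mult_left_mono, auto)
        then show ?thesis using True t by (auto simp: ennreal_mult[symmetric] intro!: ennreal_leI)
      qed simp
    qed
    finally have "epowr (ennreal ((1 - ln t) powr (- \<eta>)) * ?J) (1 / p) \<le> epowr ?I (1 / p)"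
      using assms by (intro epowr_mono) auto
    then show "ennreal ((1 - ln t) powr (- \<eta> / p)) * epowr ?J (1 / p) \<le> epowr ?I (1 / p)"
      by (simp add: epowr_mult epowr_ennreal powr_powr)
  qed
  then have "epowr (grand_norm M p \<eta> f) p \<le> epowr (epowr ?I (1 / p)) p"
    using assms by (intro epowr_mono) auto
  then show ?thesis using assms by (simp add: epowr_cancel)
qed

definition rearr_mass :: "'a measure \<Rightarrow> real \<Rightarrow> ('a \<Rightarrow> real) \<Rightarrow> nat \<Rightarrow> ennreal" where
  "rearr_mass M p f k = (\<integral>\<^sup>+\<sigma>\<in>block k. ennreal (decr_rearr M f \<sigma> powr p) \<partial>lborel)"

text \<open>Halving the argument of the rearrangements of \<open>f0\<close> and \<open>f1\<close> carries block \<open>k\<close> into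
  \<open>(knot (k + 2), 1)\<close>; the dilation costs a factor \<open>2\<close>, the \<open>p\<close>-th power of a sum a factor \<open>2 powr p\<close>.\<close>

lemma rearr_mass_add_le:
  assumes "finite_measure M" "f \<in> borel_measurable M" "f0 \<in> borel_measurable M" "f1 \<in> borel_measurable M"
    and "AE x in M. f x = f0 x + f1 x" "0 < p"
  shows "rearr_mass M p f k \<le> ennreal (2 powr (p + 1)) *
    ((\<integral>\<^sup>+\<sigma>\<in>{knot (k + 2)<..<1}. ennreal (decr_rearr M f0 \<sigma> powr p) \<partial>lborel)
     + (\<integral>\<^sup>+\<sigma>\<in>{knot (k + 2)<..<1}. ennreal (decr_rearr M f1 \<sigma> powr p) \<partial>lborel))"
proof -
  note [measurable] = decr_rearr_measurable[OF assms(1,3)] decr_rearr_measurable[OF assms(1,4)]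
  define F where "F g \<tau> = ennreal (decr_rearr M g \<tau> powr p) * indicator {knot (k + 2)<..<1} \<tau>" for g \<tau>
  have F0[measurable]: "F f0 \<in> borel_measurable borel" unfolding F_def by measurable
  have F1[measurable]: "F f1 \<in> borel_measurable borel" unfolding F_def by measurable
  have dil: "(\<integral>\<^sup>+\<sigma>. G (\<sigma> / 2) \<partial>lborel) = ennreal 2 * (\<integral>\<^sup>+\<sigma>. G \<sigma> \<partial>lborel)"
    if [measurable]: "G \<in> borel_measurable borel" for G :: "real \<Rightarrow> ennreal"
    by (subst nn_integral_real_affine[where c = 2 and t = 0]) auto
  have "rearr_mass M p f k \<le> (\<integral>\<^sup>+\<sigma>. ennreal (2 powr p) * (F f0 (\<sigma> / 2) + F f1 (\<sigma> / 2)) \<partial>lborel)"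
    unfolding rearr_mass_def
  proof (rule nn_integral_mono)
    fix \<sigma> :: real
    let ?u = "decr_rearr M f \<sigma>" and ?v = "decr_rearr M f0 (\<sigma> / 2)" and ?w = "decr_rearr M f1 (\<sigma> / 2)"
    show "ennreal (?u powr p) * indicator (block k) \<sigma> \<le> ennreal (2 powr p) * (F f0 (\<sigma> / 2) + F f1 (\<sigma> / 2))"
    proof (cases "\<sigma> \<in> block k")
      case True
      then have pos: "0 < \<sigma>" using block_log_bounds(3) by blast
      then have "0 < \<sigma> / 2" by simp
      note nonneg = decr_rearr_nonneg[OF assms(1,2) pos] decr_rearr_nonneg[OF assms(1,3) this] decr_rearr_nonneg[OF assms(1,4) this]
      have "knot k \<le> 1" using decseqD[OF decseq_knot, of 0 k] by (simp add: knot_zero)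
      moreover have "2 * knot (k + 2) < knot (Suc k)" using two_knot_Suc_less[of "Suc k"] by simp
      ultimately have half: "\<sigma> / 2 \<in> {knot (k + 2)<..<1}" using True by auto
      have "ennreal (?u powr p) = epowr (ennreal ?u) p" using nonneg by (simp add: epowr_ennreal)
      also have "\<dots> \<le> epowr (ennreal ?v + ennreal ?w) p"
        using nonneg decr_rearr_add[OF assms(1,3,4) pos assms(5)] assms(6)
        by (intro epowr_mono) (auto simp flip: ennreal_plus intro!: ennreal_leI)
      also have "\<dots> \<le> ennreal (2 powr p) * (epowr (ennreal ?v) p + epowr (ennreal ?w) p)"
        using assms by (intro epowr_add_le) auto
      also have "\<dots> = ennreal (2 powr p) * (F f0 (\<sigma> / 2) + F f1 (\<sigma> / 2))"
        using nonneg half by (simp add: epowr_ennreal F_def)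
      finally show ?thesis using True by simp
    qed simp
  qed
  also have "\<dots> = ennreal (2 powr p) * ((\<integral>\<^sup>+\<sigma>. F f0 (\<sigma> / 2) \<partial>lborel) + (\<integral>\<^sup>+\<sigma>. F f1 (\<sigma> / 2) \<partial>lborel))"
    by (simp add: nn_integral_cmult nn_integral_add)
  also have "\<dots> = ennreal (2 powr p) * (ennreal 2 * ((\<integral>\<^sup>+\<sigma>. F f0 \<sigma> \<partial>lborel) + (\<integral>\<^sup>+\<sigma>. F f1 \<sigma> \<partial>lborel)))"
    by (simp only: dil[OF F0] dil[OF F1] distrib_left)
  also have "\<dots> = ennreal (2 powr (p + 1)) * ((\<integral>\<^sup>+\<sigma>. F f0 \<sigma> \<partial>lborel) + (\<integral>\<^sup>+\<sigma>. F f1 \<sigma> \<partial>lborel))"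
    by (subst mult.assoc[symmetric], subst ennreal_mult[symmetric]) (simp_all add: powr_add)
  finally show ?thesis unfolding F_def .
qed

text \<open>On block \<open>k\<close> the rearrangement is at least its value at \<open>knot k\<close>, and the block has at least
  half of the length \<open>knot k\<close>.\<close>

lemma rearr_mass_ge:
  assumes "finite_measure M" "f \<in> borel_measurable M" "0 < p"
  shows "ennreal (decr_rearr M f (knot k) powr p * knot k) \<le> 2 * rearr_mass M p f k"
proof -
  let ?u = "decr_rearr M f (knot k)"
  have "ennreal (?u powr p * knot k) \<le> ennreal (2 * (?u powr p * (knot k - knot (Suc k))))"
  proof (rule ennreal_leI)
    have "knot k \<le> 2 * (knot k - knot (Suc k))" using two_knot_Suc_less[of k] by simp
    then have "?u powr p * knot k \<le> ?u powr p * (2 * (knot k - knot (Suc k)))"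
      by (intro mult_left_mono) auto
    then show "?u powr p * knot k \<le> 2 * (?u powr p * (knot k - knot (Suc k)))"
      by (simp only: mult.left_commute)
  qed
  also have "\<dots> = 2 * (\<integral>\<^sup>+\<sigma>\<in>block k. ennreal (?u powr p) \<partial>lborel)"
    using decseqD[OF decseq_knot, of k "Suc k"] by (simp add: nn_integral_cmult_indicator ennreal_mult)
  also have "\<dots> \<le> 2 * rearr_mass M p f k"
    unfolding rearr_mass_def
  proof (intro mult_left_mono nn_integral_mono)
    fix \<sigma> :: real
    show "ennreal (?u powr p) * indicator (block k) \<sigma> \<le> ennreal (decr_rearr M f \<sigma> powr p) * indicator (block k) \<sigma>"
    proof (cases "\<sigma> \<in> block k")
      case True
      then have "?u \<le> decr_rearr M f \<sigma>"
        using block_log_bounds(3)[OF True] by (intro decr_rearr_antimono[OF assms(1,2)]) auto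
      then show ?thesis
        using assms(3) decr_rearr_nonneg[OF assms(1,2) knot_pos]
        by (intro mult_right_mono ennreal_leI powr_mono2) auto
    qed simp
  qed simp
  finally show ?thesis .
qed

text \<open>The inner integral of the Gamma norm at \<open>t\<close> contains the whole mass of a block only if \<open>t\<close> lies to
  the right of that block, and no point of \<open>(0,1)\<close> lies to the right of block \<open>0\<close>. Monotonicity of the rearrangement recovers its mass from
  block \<open>1\<close>.\<close>

lemma rearr_mass_0_le:
  assumes "finite_measure M" "f \<in> borel_measurable M" "0 < p"
  shows "rearr_mass M p f 0 \<le> ennreal (2 / knot 1) * rearr_mass M p f 1"
proof -
  let ?u = "decr_rearr M f (knot 1)"
  have "rearr_mass M p f 0 \<le> (\<integral>\<^sup>+\<sigma>\<in>block 0. ennreal (?u powr p) \<partial>lborel)"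
    unfolding rearr_mass_def
  proof (intro nn_integral_mono)
    fix \<sigma> :: real
    show "ennreal (decr_rearr M f \<sigma> powr p) * indicator (block 0) \<sigma> \<le> ennreal (?u powr p) * indicator (block 0) \<sigma>"
    proof (cases "\<sigma> \<in> block 0")
      case True
      then have "decr_rearr M f \<sigma> \<le> ?u"
        using knot_pos[of 1] by (intro decr_rearr_antimono[OF assms(1,2)]) auto
      then show ?thesis
        using assms(3) decr_rearr_nonneg[OF assms(1,2) block_log_bounds(3)[OF True]]
        by (intro mult_right_mono ennreal_leI powr_mono2) auto
    qed simp
  qed
  also have "\<dots> = ennreal (?u powr p * (knot 0 - knot 1))"
    using decseqD[OF decseq_knot, of 0 1] by (simp add: nn_integral_cmult_indicator ennreal_mult)
  also have "\<dots> \<le> ennreal (1 / knot 1 * (?u powr p * knot 1))"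
    using knot_pos[of 1] by (intro ennreal_leI) (simp add: knot_zero mult_left_le)
  also have "\<dots> = ennreal (1 / knot 1) * ennreal (?u powr p * knot 1)"
    using knot_pos[of 1] by (intro ennreal_mult) auto
  also have "\<dots> \<le> ennreal (1 / knot 1) * (2 * rearr_mass M p f 1)"
    by (intro mult_left_mono rearr_mass_ge assms) auto
  also have "\<dots> = ennreal (1 / knot 1) * ennreal 2 * rearr_mass M p f 1"
    by (simp add: mult.assoc)
  also have "ennreal (1 / knot 1) * ennreal 2 = ennreal (2 / knot 1)"
    using knot_pos[of 1] by (subst ennreal_mult[symmetric]) auto
  finally show ?thesis .
qed

lemma powr_minus_le_dyadic:
  fixes x \<eta> :: real
  assumes "0 \<le> \<eta>" "2 ^ j \<le> x"
  shows "x powr (- \<eta>) \<le> 2 powr (- (\<eta> * real j))"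
proof -
  have "x powr (- \<eta>) \<le> (2 ^ j) powr (- \<eta>)"
    using assms by (intro powr_mono2') auto
  also have "(2 ^ j) powr (- \<eta>) = 2 powr (- (\<eta> * real j))"
    by (simp add: powr_powr mult.commute flip: powr_realpow)
  finally show ?thesis .
qed

text \<open>The absolute value of the exponent covers both signs: the logarithm in the outer weight of the
  Gamma norm carries the exponent \<open>r * \<theta> / p * (\<alpha> - \<beta>) - 1\<close>, which can be negative.\<close>

lemma powr_dyadic_bounds:
  fixes a x e :: real
  assumes "0 < a" "a \<le> x" "x \<le> 2 * a"
  shows "2 powr (- \<bar>e\<bar>) * a powr e \<le> x powr e" "x powr e \<le> 2 powr \<bar>e\<bar> * a powr e"
proof -
  define y where "y = x / a"
  have y: "1 \<le> y" "y \<le> 2" and x: "x = y * a" using assms by (auto simp: y_def field_simps)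
  have "2 powr (- \<bar>e\<bar>) \<le> y powr (- \<bar>e\<bar>)" using y by (intro powr_mono2') auto
  also have "\<dots> \<le> y powr e" using y by (intro powr_mono) auto
  finally have lower: "2 powr (- \<bar>e\<bar>) \<le> y powr e" .
  have "y powr e \<le> y powr \<bar>e\<bar>" using y by (intro powr_mono) auto
  also have "\<dots> \<le> 2 powr \<bar>e\<bar>" using y by (intro powr_mono2) auto
  finally have upper: "y powr e \<le> 2 powr \<bar>e\<bar>" .
  have "x powr e = y powr e * a powr e" unfolding x using y assms by (intro powr_mult) 
  with lower upper show "2 powr (- \<bar>e\<bar>) * a powr e \<le> x powr e" "x powr e \<le> 2 powr \<bar>e\<bar> * a powr e"
    by (simp_all add: mult_right_mono)
qed

section \<open>Discretising the couple of grand Lebesgue spaces\<close>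

locale grand_couple = finite_measure M for M :: "'a measure" +
  fixes p \<alpha> \<beta> \<theta> r :: real
  assumes p: "0 < p" and \<beta>: "0 < \<beta>" and \<beta>_less_\<alpha>: "\<beta> < \<alpha>"
    and \<theta>: "0 < \<theta>" "\<theta> < 1" and r: "0 < r"
begin

abbreviation "K \<equiv> K_functional M (grand_Lebesgue M p \<alpha>) (grand_Lebesgue M p \<beta>)"

abbreviation "mass \<equiv> rearr_mass M p"

text \<open>The scale at which block \<open>k\<close> is visible to the K-functional: if the mass of the rearrangement
  is concentrated on block \<open>k\<close>, the two norms differ by a factor comparable to \<open>2 powr (k * (\<alpha> - \<beta>) / p)\<close>, the reciprocal of \<open>\<rho> k\<close>.\<close>

definition \<rho> :: "nat \<Rightarrow> real" where
  "\<rho> k = 2 powr (- ((\<alpha> - \<beta>) / p * real k))"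

definition coef :: "('a \<Rightarrow> real) \<Rightarrow> nat \<Rightarrow> ennreal" where
  "coef f k = ennreal (2 powr ((\<theta> * (\<alpha> - \<beta>) - \<alpha>) * real k)) * mass f k"

definition dyadic_sum :: "('a \<Rightarrow> real) \<Rightarrow> ennreal" where
  "dyadic_sum f = (\<Sum>k. epowr (coef f k) (r / p))"

text \<open>The minimum of the two rates \<open>\<theta> * (\<alpha> - \<beta>)\<close> of the tail sum and \<open>(1 - \<theta>) * (\<alpha> - \<beta>)\<close> of the head
  sum, so that a single two-sided kernel dominates both.\<close>

definition decay :: real where
  "decay = 2 powr (- (min \<theta> (1 - \<theta>) * (\<alpha> - \<beta>)))"

definition smoothed :: "('a \<Rightarrow> real) \<Rightarrow> nat \<Rightarrow> ennreal" where
  "smoothed f k = (\<Sum>j. ennreal (decay ^ ((j - k) + (k - j))) * coef f j)"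

definition inner_integral :: "('a \<Rightarrow> real) \<Rightarrow> real \<Rightarrow> ennreal" where
  "inner_integral f t = (\<integral>\<^sup>+\<sigma>\<in>{0<..<t}. ennreal (decr_rearr M f \<sigma> powr p * (1 - ln \<sigma>) powr (- \<alpha>)) \<partial>lborel)"

definition interp_integral :: "('a \<Rightarrow> real) \<Rightarrow> ennreal" where
  "interp_integral f = (\<integral>\<^sup>+t\<in>{0<..<1}. epowr (ennreal (t powr (- \<theta>)) * K f t) r * ennreal (1 / t) \<partial>lborel)"

definition gamma_integral :: "('a \<Rightarrow> real) \<Rightarrow> ennreal" where
  "gamma_integral f = (\<integral>\<^sup>+t\<in>{0<..<1}. ennreal (t powr (- 1) * (1 - ln t) powr (r * \<theta> / p * (\<alpha> - \<beta>) - 1))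
     * epowr (inner_integral f t) (r / p) \<partial>lborel)"

lemma fin: "finite_measure M" by (rule finite_measure_axioms)

lemma decay: "0 < decay" "decay < 1"
  using \<theta> \<beta>_less_\<alpha> powr_less_mono[of "- (min \<theta> (1 - \<theta>) * (\<alpha> - \<beta>))" 0 2] by (auto simp: decay_def)

lemma sum_epowr_smoothed_le:
  obtains C :: real where "0 < C" "\<And>f. (\<Sum>k. epowr (smoothed f k) (r / p)) \<le> ennreal C * dyadic_sum f"
proof -
  have "0 < r / p" using p r by simp
  from discrete_hardy[OF decay this] obtain C :: real where C: "0 < C"
    "\<And>c :: nat \<Rightarrow> ennreal. (\<Sum>k. epowr (\<Sum>j. ennreal (decay ^ ((j - k) + (k - j))) * c j) (r / p)) \<le> ennreal C * (\<Sum>j. epowr (c j) (r / p))"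
    by blast
  show thesis
    by (rule that[OF C(1)], unfold smoothed_def dyadic_sum_def, rule C(2))
qed

lemma decay_power: "decay ^ n = 2 powr (- (min \<theta> (1 - \<theta>) * (\<alpha> - \<beta>) * real n))"
  by (simp add: decay_def powr_power mult_ac)

text \<open>In terms of \<open>coef\<close>, the term \<open>j \<ge> k\<close> on the left is
  \<open>2 powr (- \<theta> (\<alpha> - \<beta>) (j - k)) * coef f j\<close>.\<close>

lemma tail_le_smoothed:
  "ennreal (2 powr (\<theta> * (\<alpha> - \<beta>) * real k)) * (\<Sum>j. ennreal (if k \<le> j then 2 powr (- (\<alpha> * real j)) else 0) * mass f j)
    \<le> smoothed f k"
proof -
  have "ennreal (2 powr (\<theta> * (\<alpha> - \<beta>) * real k)) * (ennreal (if k \<le> j then 2 powr (- (\<alpha> * real j)) else 0) * mass f j)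
    \<le> ennreal (decay ^ ((j - k) + (k - j))) * coef f j" for j
  proof (cases "k \<le> j")
    case True
    have "0 \<le> (\<theta> - min \<theta> (1 - \<theta>)) * ((\<alpha> - \<beta>) * (real j - real k))"
      using True \<beta>_less_\<alpha> by (intro mult_nonneg_nonneg) auto
    then have "2 powr (\<theta> * (\<alpha> - \<beta>) * real k) * 2 powr (- (\<alpha> * real j))
      \<le> decay ^ ((j - k) + (k - j)) * 2 powr ((\<theta> * (\<alpha> - \<beta>) - \<alpha>) * real j)"
      unfolding decay_power powr_add[symmetric] using True
      by (intro powr_mono) (simp_all add: algebra_simps of_nat_diff)
    then show ?thesis
      unfolding coef_def mult.assoc[symmetric] using True decay
      by (intro mult_right_mono) (auto simp: ennreal_mult[symmetric] intro!: ennreal_leI)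
  qed simp
  then show ?thesis
    unfolding smoothed_def ennreal_suminf_cmult[symmetric] by (intro suminf_le) auto
qed

text \<open>In terms of \<open>coef\<close>, the term \<open>j \<le> k\<close> on the left is
  \<open>2 powr (- (1 - \<theta>) (\<alpha> - \<beta>) (k - j)) * coef f j\<close>.\<close>

lemma head_le_smoothed:
  "ennreal (2 powr (- ((1 - \<theta>) * (\<alpha> - \<beta>) * real k))) * (\<Sum>j. ennreal (if j \<le> k then 2 powr (- (\<beta> * real j)) else 0) * mass f j)
    \<le> smoothed f k"
proof -
  have "ennreal (2 powr (- ((1 - \<theta>) * (\<alpha> - \<beta>) * real k))) * (ennreal (if j \<le> k then 2 powr (- (\<beta> * real j)) else 0) * mass f j)
    \<le> ennreal (decay ^ ((j - k) + (k - j))) * coef f j" for j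
  proof (cases "j \<le> k")
    case True
    have "0 \<le> ((1 - \<theta>) - min \<theta> (1 - \<theta>)) * ((\<alpha> - \<beta>) * (real k - real j))"
      using True \<beta>_less_\<alpha> by (intro mult_nonneg_nonneg) auto
    then have "2 powr (- ((1 - \<theta>) * (\<alpha> - \<beta>) * real k)) * 2 powr (- (\<beta> * real j))
      \<le> decay ^ ((j - k) + (k - j)) * 2 powr ((\<theta> * (\<alpha> - \<beta>) - \<alpha>) * real j)"
      unfolding decay_power powr_add[symmetric] using True
      by (intro powr_mono) (simp_all add: algebra_simps of_nat_diff)
    then show ?thesis
      unfolding coef_def mult.assoc[symmetric] using True decay
      by (intro mult_right_mono) (auto simp: ennreal_mult[symmetric] intro!: ennreal_leI)
  qed simp
  then show ?thesis
    unfolding smoothed_def ennreal_suminf_cmult[symmetric] by (intro suminf_le) auto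
qed

section \<open>Upper bound for the K-functional\<close>

text \<open>When one of the norms is infinite the pair is not an admissible decomposition, but then the right
  side is infinite too, because \<open>t > 0\<close>.\<close>

lemma K_functional_le:
  assumes "f0 \<in> borel_measurable M" "f1 \<in> borel_measurable M" "\<And>x. f x = f0 x + f1 x" "0 < t"
  shows "K f t \<le> grand_norm M p \<alpha> f0 + ennreal t * grand_norm M p \<beta> f1"
proof (cases "grand_norm M p \<alpha> f0 = top \<or> grand_norm M p \<beta> f1 = top")
  case True
  then show ?thesis using assms(4) by (auto simp: ennreal_mult_top)
next
  case False
  then have "(f0, f1) \<in> decomps M (grand_Lebesgue M p \<alpha>) (grand_Lebesgue M p \<beta>) f"
    using assms by (auto simp: decomps_def grand_Lebesgue_def fun_space_of_def less_top)
  then have "K f t \<le> (case (f0, f1) of (f0, f1) \<Rightarrow> qnorm (grand_Lebesgue M p \<alpha>) f0 + ennreal t * qnorm (grand_Lebesgue M p \<beta>) f1)"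
    unfolding K_functional_def by (rule INF_lower)
  then show ?thesis by (simp add: grand_Lebesgue_def fun_space_of_def)
qed

text \<open>A function that vanishes where \<open>\<bar>f\<bar>\<close> does not exceed \<open>f\<^sub>* (knot k)\<close> is supported on a set of measure
  at most \<open>knot k\<close>, so its rearrangement vanishes on all blocks before the \<open>k\<close>-th.\<close>

lemma grand_norm_excess_le:
  assumes f: "f \<in> borel_measurable M" and g: "g \<in> borel_measurable M"
    and le: "\<And>x. \<bar>g x\<bar> \<le> \<bar>f x\<bar>"
    and zero: "\<And>x. \<bar>f x\<bar> \<le> decr_rearr M f (knot k) \<Longrightarrow> g x = 0"
  shows "epowr (grand_norm M p \<alpha> g) p \<le> (\<Sum>j. ennreal (if k \<le> j then 2 powr (- (\<alpha> * real j)) else 0) * mass f j)"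
proof -
  note [measurable] = decr_rearr_measurable[OF fin f] f g
  have "epowr (grand_norm M p \<alpha> g) p
      \<le> (\<integral>\<^sup>+\<sigma>\<in>{0<..<1}. ennreal (decr_rearr M g \<sigma> powr p * (1 - ln \<sigma>) powr (- \<alpha>)) \<partial>lborel)"
    using p \<beta> \<beta>_less_\<alpha> by (intro grand_norm_powr_le fin g) auto
  also have "\<dots> \<le> (\<Sum>j. ennreal (if k \<le> j then 2 powr (- (\<alpha> * real j)) else 0) * mass f j)"
    unfolding UN_block[symmetric] rearr_mass_def
  proof (rule nn_integral_UN_le)
    fix j \<sigma> assume \<sigma>: "\<sigma> \<in> block j"
    note pos = block_log_bounds(3)[OF \<sigma>]
    have gf: "0 \<le> decr_rearr M g \<sigma>" "decr_rearr M g \<sigma> \<le> decr_rearr M f \<sigma>"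
      using decr_rearr_nonneg[OF fin g pos] decr_rearr_mono[OF fin f pos le] by auto
    show "ennreal (decr_rearr M g \<sigma> powr p * (1 - ln \<sigma>) powr (- \<alpha>))
      \<le> ennreal (if k \<le> j then 2 powr (- (\<alpha> * real j)) else 0) * ennreal (decr_rearr M f \<sigma> powr p)"
    proof (cases "k \<le> j")
      case True
      have "(1 - ln \<sigma>) powr (- \<alpha>) \<le> 2 powr (- (\<alpha> * real j))"
        using \<beta> \<beta>_less_\<alpha> by (intro powr_minus_le_dyadic block_log_bounds[OF \<sigma>]) auto
      moreover have "decr_rearr M g \<sigma> powr p \<le> decr_rearr M f \<sigma> powr p"
        using gf p by (intro powr_mono2) auto
      ultimately have "decr_rearr M g \<sigma> powr p * (1 - ln \<sigma>) powr (- \<alpha>) \<le> decr_rearr M f \<sigma> powr p * 2 powr (- (\<alpha> * real j))"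
        by (intro mult_mono) auto
      then show ?thesis using True by (simp add: ennreal_mult[symmetric] mult.commute ennreal_leI)
    next
      case False
      then have knot: "knot k \<le> \<sigma>" using \<sigma> decseqD[OF decseq_knot, of "Suc j" k] by auto
      have "{x \<in> space M. \<bar>g x\<bar> > 0} \<subseteq> {x \<in> space M. \<bar>f x\<bar> > decr_rearr M f (knot k)}"
        using zero by (auto simp: not_le[symmetric])
      then have "emeasure M {x \<in> space M. \<bar>g x\<bar> > 0} \<le> emeasure M {x \<in> space M. \<bar>f x\<bar> > decr_rearr M f (knot k)}"
        by (intro emeasure_mono) auto
      also have "\<dots> \<le> ennreal (knot k)" by (rule emeasure_gt_decr_rearr[OF fin f knot_pos])
      also have "\<dots> \<le> ennreal \<sigma>" using knot by (rule ennreal_leI)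
      finally have "decr_rearr M g \<sigma> \<le> 0" by (intro decr_rearr_le) auto
      then show ?thesis using gf by simp
    qed
  qed auto
  finally show ?thesis .
qed

text \<open>To the right of \<open>knot k\<close> the rearrangement of \<open>g\<close> is controlled by that of \<open>f\<close>, which gives the
  blocks before the \<open>k\<close>-th. To the left of \<open>knot k\<close> it is at most \<open>f\<^sub>* (knot k)\<close>, and the contribution
  of this constant is absorbed by the mass of block \<open>k\<close>; the factor \<open>3 = 1 + 2\<close> collects both parts.\<close>

lemma grand_norm_truncation_le:
  assumes f: "f \<in> borel_measurable M" and g: "g \<in> borel_measurable M"
    and le: "\<And>x. \<bar>g x\<bar> \<le> \<bar>f x\<bar>"
    and bound: "\<And>x. \<bar>g x\<bar> \<le> decr_rearr M f (knot k)"
  shows "epowr (grand_norm M p \<beta> g) p \<le> 3 * (\<Sum>j. ennreal (if j \<le> k then 2 powr (- (\<beta> * real j)) else 0) * mass f j)"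
    (is "_ \<le> 3 * ?S")
proof -
  note [measurable] = decr_rearr_measurable[OF fin f] f g
  let ?u = "decr_rearr M f (knot k)"
  define G where "G \<sigma> = ennreal (decr_rearr M f \<sigma> powr p * (1 - ln \<sigma>) powr (- \<beta>)) * indicator {knot k..<1} \<sigma>" for \<sigma>
  have [measurable]: "G \<in> borel_measurable borel" unfolding G_def by measurable
  have weight: "(1 - ln \<sigma>) powr (- \<beta>) \<le> 2 powr (- (\<beta> * real j))" if "2 ^ j \<le> 1 - ln \<sigma>" for \<sigma> :: real and j
    using \<beta> that by (intro powr_minus_le_dyadic) auto
  have "epowr (grand_norm M p \<beta> g) p
      \<le> (\<integral>\<^sup>+\<sigma>\<in>{0<..<1}. ennreal (decr_rearr M g \<sigma> powr p * (1 - ln \<sigma>) powr (- \<beta>)) \<partial>lborel)"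
    using p \<beta> by (intro grand_norm_powr_le fin g) auto
  also have "\<dots> \<le> (\<integral>\<^sup>+\<sigma>. G \<sigma> + ennreal (2 powr (- (\<beta> * real k)) * ?u powr p) * indicator {0<..<knot k} \<sigma> \<partial>lborel)"
  proof (rule nn_integral_mono)
    fix \<sigma> :: real
    show "ennreal (decr_rearr M g \<sigma> powr p * (1 - ln \<sigma>) powr (- \<beta>)) * indicator {0<..<1} \<sigma>
      \<le> G \<sigma> + ennreal (2 powr (- (\<beta> * real k)) * ?u powr p) * indicator {0<..<knot k} \<sigma>"
    proof (cases "\<sigma> \<in> {0<..<1}")
      case True
      then have pos: "0 < \<sigma>" by simp
      have g0: "0 \<le> decr_rearr M g \<sigma>" by (rule decr_rearr_nonneg[OF fin g pos])
      show ?thesis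
      proof (cases "knot k \<le> \<sigma>")
        case k: True
        have "decr_rearr M g \<sigma> powr p \<le> decr_rearr M f \<sigma> powr p"
          using decr_rearr_mono[OF fin f pos le] g0 p by (intro powr_mono2) auto
        then show ?thesis
          using True k by (auto simp: G_def intro!: ennreal_leI mult_right_mono)
      next
        case k: False
        have "{x \<in> space M. \<bar>g x\<bar> > ?u} = {}" using bound by (auto simp: not_less)
        then have "emeasure M {x \<in> space M. \<bar>g x\<bar> > ?u} \<le> ennreal \<sigma>" by (simp only: emeasure_empty zero_le)
        then have "decr_rearr M g \<sigma> \<le> ?u"
          using decr_rearr_nonneg[OF fin f knot_pos] by (intro decr_rearr_le) auto
        then have "decr_rearr M g \<sigma> powr p \<le> ?u powr p" using g0 p by (intro powr_mono2) auto
        moreover have "(1 - ln \<sigma>) powr (- \<beta>) \<le> 2 powr (- (\<beta> * real k))"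
        proof (rule weight)
          have "ln \<sigma> \<le> ln (knot k)" using k pos by (intro ln_mono) auto
          then show "2 ^ k \<le> 1 - ln \<sigma>" using ln_knot[of k] by simp
        qed
        ultimately have "decr_rearr M g \<sigma> powr p * (1 - ln \<sigma>) powr (- \<beta>) \<le> ?u powr p * 2 powr (- (\<beta> * real k))"
          by (intro mult_mono) auto
        then show ?thesis
          using True k by (auto simp: G_def mult.commute intro!: ennreal_leI)
      qed
    qed simp
  qed
  also have "\<dots> = (\<integral>\<^sup>+\<sigma>. G \<sigma> \<partial>lborel) + ennreal (2 powr (- (\<beta> * real k)) * ?u powr p) * ennreal (knot k)"
    using knot_pos[of k] by (subst nn_integral_add) (simp_all add: nn_integral_cmult_indicator)
  also have "\<dots> \<le> ?S + 2 * ?S"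
  proof (rule add_mono)
    have "(\<integral>\<^sup>+\<sigma>. G \<sigma> \<partial>lborel) = (\<integral>\<^sup>+\<sigma>\<in>{0<..<1}. G \<sigma> \<partial>lborel)"
      using knot_pos[of k] by (intro nn_integral_cong) (auto simp: G_def indicator_def)
    also have "\<dots> \<le> ?S"
      unfolding UN_block[symmetric] rearr_mass_def
    proof (rule nn_integral_UN_le)
      fix j \<sigma> assume \<sigma>: "\<sigma> \<in> block j"
      show "G \<sigma> \<le> ennreal (if j \<le> k then 2 powr (- (\<beta> * real j)) else 0) * ennreal (decr_rearr M f \<sigma> powr p)"
      proof (cases "j \<le> k")
        case True
        have "decr_rearr M f \<sigma> powr p * (1 - ln \<sigma>) powr (- \<beta>) \<le> decr_rearr M f \<sigma> powr p * 2 powr (- (\<beta> * real j))"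
          using weight[OF block_log_bounds(1)[OF \<sigma>]] by (intro mult_left_mono) auto
        then show ?thesis using True
          by (auto simp: G_def ennreal_mult[symmetric] mult.commute indicator_def intro!: ennreal_leI)
      next
        case False
        then have "\<sigma> < knot k" using \<sigma> decseqD[OF decseq_knot, of k j] by auto
        then show ?thesis by (simp add: G_def)
      qed
    qed auto
    finally show "(\<integral>\<^sup>+\<sigma>. G \<sigma> \<partial>lborel) \<le> ?S" .
    have "ennreal (2 powr (- (\<beta> * real k)) * ?u powr p) * ennreal (knot k)
        = ennreal (2 powr (- (\<beta> * real k))) * ennreal (?u powr p * knot k)"
      using knot_pos[of k] by (simp add: ennreal_mult[symmetric] mult.assoc)
    also have "\<dots> \<le> ennreal (2 powr (- (\<beta> * real k))) * (2 * mass f k)"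
      by (intro mult_left_mono rearr_mass_ge fin f p) auto
    also have "\<dots> = 2 * (ennreal (if k \<le> k then 2 powr (- (\<beta> * real k)) else 0) * mass f k)"
      by (simp add: mult.left_commute)
    also have "\<dots> \<le> 2 * ?S"
      by (intro mult_left_mono term_le_suminf_ennreal[of "\<lambda>j. ennreal (if j \<le> k then 2 powr (- (\<beta> * real j)) else 0) * mass f j"]) auto
    finally show "ennreal (2 powr (- (\<beta> * real k)) * ?u powr p) * ennreal (knot k) \<le> 2 * ?S" .
  qed
  also have "\<dots> = 3 * ?S" by (simp add: distrib_right[of 1 2 ?S, simplified, symmetric])
  finally show ?thesis .
qed

lemma \<rho>_powr_p: "\<rho> k powr p = 2 powr (- ((\<alpha> - \<beta>) * real k))"
  using p by (simp add: \<rho>_def powr_powr)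

text \<open>The decomposition truncates \<open>f\<close> at height \<open>f\<^sub>* (knot k)\<close>: the excess goes to the larger space, the
  truncation to the smaller one.\<close>

lemma K_le_smoothed:
  assumes f: "f \<in> borel_measurable M" and t: "0 < t" "t \<le> \<rho> k"
  shows "ennreal (2 powr (\<theta> * (\<alpha> - \<beta>) * real k)) * epowr (K f t) p \<le> ennreal (2 powr p * 4) * smoothed f k"
proof -
  define u where "u = decr_rearr M f (knot k)"
  define f1 where "f1 x = max (- u) (min u (f x))" for x
  define f0 where "f0 x = f x - f1 x" for x
  have u: "0 \<le> u" unfolding u_def by (rule decr_rearr_nonneg[OF fin f knot_pos])
  note [measurable] = f
  have f1_meas[measurable]: "f1 \<in> borel_measurable M" unfolding f1_def by measurable
  have f0_meas: "f0 \<in> borel_measurable M" unfolding f0_def by measurable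
  define S0 where "S0 = (\<Sum>j. ennreal (if k \<le> j then 2 powr (- (\<alpha> * real j)) else 0) * mass f j)"
  define S1 where "S1 = (\<Sum>j. ennreal (if j \<le> k then 2 powr (- (\<beta> * real j)) else 0) * mass f j)"
  have N0: "epowr (grand_norm M p \<alpha> f0) p \<le> S0"
    unfolding S0_def using u by (intro grand_norm_excess_le f f0_meas) (auto simp: f0_def f1_def u_def)
  have N1: "epowr (grand_norm M p \<beta> f1) p \<le> 3 * S1"
    unfolding S1_def using u by (intro grand_norm_truncation_le f f1_meas) (auto simp: f1_def u_def)
  let ?w = "ennreal (2 powr (\<theta> * (\<alpha> - \<beta>) * real k))"
  have "epowr (K f t) p \<le> epowr (grand_norm M p \<alpha> f0 + ennreal t * grand_norm M p \<beta> f1) p"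
    using p t by (intro epowr_mono K_functional_le f0_meas f1_meas) (auto simp: f0_def)
  also have "\<dots> \<le> ennreal (2 powr p) * (epowr (grand_norm M p \<alpha> f0) p + epowr (ennreal t * grand_norm M p \<beta> f1) p)"
    using p by (intro epowr_add_le) auto
  also have "\<dots> = ennreal (2 powr p) * (epowr (grand_norm M p \<alpha> f0) p + ennreal (t powr p) * epowr (grand_norm M p \<beta> f1) p)"
    using t by (simp add: epowr_mult epowr_ennreal)
  also have "\<dots> \<le> ennreal (2 powr p) * (S0 + ennreal (2 powr (- ((\<alpha> - \<beta>) * real k))) * (3 * S1))"
    using t p by (intro mult_left_mono add_mono mult_mono N0 N1 ennreal_leI) (auto simp flip: \<rho>_powr_p intro: powr_mono2)
  finally have "?w * epowr (K f t) p \<le> ?w * (ennreal (2 powr p) * (S0 + ennreal (2 powr (- ((\<alpha> - \<beta>) * real k))) * (3 * S1)))"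
    by (rule mult_left_mono) simp
  also have "\<dots> = ennreal (2 powr p) * (?w * S0 + 3 * ((?w * ennreal (2 powr (- ((\<alpha> - \<beta>) * real k)))) * S1))"
    by (simp add: distrib_left mult_ac)
  also have "?w * ennreal (2 powr (- ((\<alpha> - \<beta>) * real k))) = ennreal (2 powr (- ((1 - \<theta>) * (\<alpha> - \<beta>) * real k)))"
    by (simp add: ennreal_mult[symmetric] powr_add[symmetric] algebra_simps)
  also have "ennreal (2 powr p) * (?w * S0 + 3 * (ennreal (2 powr (- ((1 - \<theta>) * (\<alpha> - \<beta>) * real k))) * S1))
     \<le> ennreal (2 powr p) * (smoothed f k + 3 * smoothed f k)"
    unfolding S0_def S1_def by (intro mult_left_mono add_mono tail_le_smoothed head_le_smoothed) auto
  also have "smoothed f k + 3 * smoothed f k = ennreal 4 * smoothed f k"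
    using distrib_right[of 1 3 "smoothed f k"] by simp
  also have "ennreal (2 powr p) * (ennreal 4 * smoothed f k) = ennreal (2 powr p * 4) * smoothed f k"
    by (subst ennreal_mult) (auto simp: mult.assoc)
  finally show ?thesis .
qed

section \<open>The interpolation norm is dyadic\<close>

lemma \<rho>_pos: "0 < \<rho> k" by (simp add: \<rho>_def)

lemma \<rho>_zero: "\<rho> 0 = 1" by (simp add: \<rho>_def)

lemma decseq_\<rho>: "decseq \<rho>"
  using \<beta>_less_\<alpha> p by (auto simp: decseq_def \<rho>_def intro!: powr_mono divide_right_mono mult_left_mono)

lemma \<rho>_tendsto_0: "\<rho> \<longlonglongrightarrow> 0"
proof -
  have eq: "\<rho> = (\<lambda>k. (2 powr (- ((\<alpha> - \<beta>) / p))) ^ k)"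
    by (simp add: \<rho>_def powr_power fun_eq_iff mult_ac)
  have "2 powr (- ((\<alpha> - \<beta>) / p)) < 2 powr 0" using \<beta>_less_\<alpha> p by (intro powr_less_mono) auto
  then show ?thesis unfolding eq by (intro LIMSEQ_realpow_zero) auto
qed

abbreviation scale_block :: "nat \<Rightarrow> real set" where
  "scale_block k \<equiv> {\<rho> (Suc k)..<\<rho> k}"

lemma UN_scale_block: "(\<Union>k. scale_block k) = {0<..<1}"
  using UN_intervals_decseq[OF decseq_\<rho> \<rho>_tendsto_0 \<rho>_pos] by (simp add: \<rho>_zero)

lemma nn_integral_reciprocal_scale_block:
  "(\<integral>\<^sup>+t\<in>scale_block k. ennreal (1 / t) \<partial>lborel) = ennreal ((\<alpha> - \<beta>) / p * ln 2)"
proof -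
  have "ln (\<rho> k) - ln (\<rho> (Suc k)) = (\<alpha> - \<beta>) / p * ln 2"
    by (simp add: \<rho>_def algebra_simps add_divide_distrib diff_divide_distrib)
  then show ?thesis
    using nn_integral_reciprocal[of "\<rho> (Suc k)" "\<rho> k"] decseqD[OF decseq_\<rho>, of k "Suc k"] by (simp add: \<rho>_pos)
qed

text \<open>For any decomposition, the mass of block \<open>k\<close> is controlled by the integrals of \<open>f0\<^sub>* powr p\<close> and
  \<open>f1\<^sub>* powr p\<close> over \<open>(knot (k + 2), 1)\<close>, and each of these by the corresponding grand norm, at a
  cost of \<open>2 powr (\<alpha> (k + 2))\<close> and \<open>2 powr (\<beta> (k + 2))\<close>. The quotient of the two costs is
  comparable to \<open>\<rho> (Suc k) powr p\<close>, hence at most a multiple of \<open>t powr p\<close>.\<close>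

lemma K_ge_mass:
  assumes f: "f \<in> borel_measurable M" and t: "\<rho> (Suc k) \<le> t"
  shows "ennreal (2 powr (- (\<alpha> * real k))) * mass f k \<le> ennreal (2 powr (p + 2 + 2 * \<alpha> + \<beta>)) * epowr (K f t) p"
proof -
  \<comment> \<open>Large enough to dominate the constants in front of both norms.\<close>
  define D where "D = 2 powr (p + 1 + 2 * \<alpha> + \<beta>)"
  have D: "0 < D" by (simp add: D_def)
  have tpos: "0 < t" using t \<rho>_pos[of "Suc k"] by linarith
  let ?x = "ennreal (2 powr (- (\<alpha> * real k))) * mass f k"
  \<comment> \<open>Taking p-th roots first makes the bound one for each member of the infimum.\<close>
  have "epowr (ennreal (1 / (2 * D)) * ?x) (1 / p) \<le> K f t"
    unfolding K_functional_def
  proof (rule INF_greatest)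
    fix fs assume "fs \<in> decomps M (grand_Lebesgue M p \<alpha>) (grand_Lebesgue M p \<beta>) f"
    then obtain f0 f1 where fs: "fs = (f0, f1)" and f0: "f0 \<in> borel_measurable M" and f1: "f1 \<in> borel_measurable M"
      and ae: "AE x in M. f x = f0 x + f1 x"
      by (auto simp: decomps_def grand_Lebesgue_def fun_space_of_def)
    let ?A = "epowr (grand_norm M p \<alpha> f0) p" and ?B = "epowr (grand_norm M p \<beta> f1) p"
    have knot: "0 < knot (k + 2)" "knot (k + 2) < 1"
      using knot_pos[of "k + 2"] two_knot_Suc_less[of "k + 1"] decseqD[OF decseq_knot, of 0 "k + 1"]
      by (auto simp: knot_zero)
    have log_knot: "(1 - ln (knot (k + 2))) powr \<eta> = 2 powr (\<eta> * (real k + 2))" for \<eta>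
    proof -
      have "(2::real) ^ (k + 2) = 2 powr (real k + 2)"
        by (subst powr_realpow[symmetric]) (simp_all add: add.commute)
      then show ?thesis unfolding ln_knot by (simp only: powr_powr mult.commute)
    qed
    have "mass f k \<le> ennreal (2 powr (p + 1)) * (ennreal (2 powr (\<alpha> * (real k + 2))) * ?A + ennreal (2 powr (\<beta> * (real k + 2))) * ?B)"
      using nn_integral_le_grand_norm[OF p knot, of M f0 \<alpha>] nn_integral_le_grand_norm[OF p knot, of M f1 \<beta>]
      unfolding log_knot
      by (intro order_trans[OF rearr_mass_add_le[OF fin f f0 f1 ae p]] mult_left_mono add_mono) auto
    then have "?x \<le> ennreal (2 powr (- (\<alpha> * real k))) *
        (ennreal (2 powr (p + 1)) * (ennreal (2 powr (\<alpha> * (real k + 2))) * ?A + ennreal (2 powr (\<beta> * (real k + 2))) * ?B))"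
      by (rule mult_left_mono) simp
    also have "\<dots> = ennreal (2 powr (- (\<alpha> * real k)) * 2 powr (p + 1) * 2 powr (\<alpha> * (real k + 2))) * ?A
        + ennreal (2 powr (- (\<alpha> * real k)) * 2 powr (p + 1) * 2 powr (\<beta> * (real k + 2))) * ?B"
      by (simp add: ennreal_mult distrib_left mult.assoc)
    also have "\<dots> \<le> ennreal D * ?A + ennreal (D * t powr p) * ?B"
    proof (intro add_mono mult_right_mono ennreal_leI)
      show "2 powr (- (\<alpha> * real k)) * 2 powr (p + 1) * 2 powr (\<alpha> * (real k + 2)) \<le> D"
        unfolding D_def powr_add[symmetric] using \<beta> by (intro powr_mono) (simp_all add: algebra_simps)
      have "2 powr (- (\<alpha> * real k)) * 2 powr (p + 1) * 2 powr (\<beta> * (real k + 2)) \<le> D * \<rho> (Suc k) powr p"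
        unfolding D_def \<rho>_powr_p powr_add[symmetric] using \<beta> \<beta>_less_\<alpha> by (intro powr_mono) (simp_all add: algebra_simps)
      also have "\<dots> \<le> D * t powr p"
        using t D p \<rho>_pos[of "Suc k"] by (intro mult_left_mono powr_mono2) auto
      finally show "2 powr (- (\<alpha> * real k)) * 2 powr (p + 1) * 2 powr (\<beta> * (real k + 2)) \<le> D * t powr p" .
    qed auto
    also have "\<dots> = ennreal D * (?A + epowr (ennreal t * grand_norm M p \<beta> f1) p)"
      using D tpos by (simp add: ennreal_mult distrib_left mult.assoc epowr_mult epowr_ennreal)
    also have "\<dots> \<le> ennreal D * (epowr (grand_norm M p \<alpha> f0 + ennreal t * grand_norm M p \<beta> f1) p
        + epowr (grand_norm M p \<alpha> f0 + ennreal t * grand_norm M p \<beta> f1) p)"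
      using p by (intro mult_left_mono add_mono epowr_mono) auto
    also have "\<dots> = ennreal (2 * D) * epowr (grand_norm M p \<alpha> f0 + ennreal t * grand_norm M p \<beta> f1) p"
      using D by (simp add: mult_2[symmetric] ennreal_mult mult_ac)
    finally have "ennreal (1 / (2 * D)) * ?x
        \<le> ennreal (1 / (2 * D)) * (ennreal (2 * D) * epowr (grand_norm M p \<alpha> f0 + ennreal t * grand_norm M p \<beta> f1) p)"
      by (rule mult_left_mono) simp
    also have "\<dots> = epowr (grand_norm M p \<alpha> f0 + ennreal t * grand_norm M p \<beta> f1) p"
      using D by (simp add: mult.assoc[symmetric] ennreal_mult[symmetric])
    finally have "epowr (ennreal (1 / (2 * D)) * ?x) (1 / p)
        \<le> epowr (epowr (grand_norm M p \<alpha> f0 + ennreal t * grand_norm M p \<beta> f1) p) (1 / p)"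
      using p by (intro epowr_mono) auto
    then show "epowr (ennreal (1 / (2 * D)) * ?x) (1 / p)
        \<le> (case fs of (f0, f1) \<Rightarrow> qnorm (grand_Lebesgue M p \<alpha>) f0 + ennreal t * qnorm (grand_Lebesgue M p \<beta>) f1)"
      using p by (simp add: fs epowr_cancel grand_Lebesgue_def fun_space_of_def)
  qed
  then have "epowr (epowr (ennreal (1 / (2 * D)) * ?x) (1 / p)) p \<le> epowr (K f t) p"
    using p by (intro epowr_mono) auto
  then have "ennreal (1 / (2 * D)) * ?x \<le> epowr (K f t) p" using p by (simp add: epowr_cancel)
  then have "ennreal (2 * D) * (ennreal (1 / (2 * D)) * ?x) \<le> ennreal (2 * D) * epowr (K f t) p"
    by (rule mult_left_mono) simp
  moreover have "ennreal (2 * D) * (ennreal (1 / (2 * D)) * ?x) = ?x"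
    using D by (simp add: mult.assoc[symmetric] ennreal_mult[symmetric])
  moreover have "2 * D = 2 powr (p + 2 + 2 * \<alpha> + \<beta>)"
    using powr_add[of 2 1 "p + 1 + 2 * \<alpha> + \<beta>"] by (simp add: D_def add_ac)
  ultimately show ?thesis by (simp only:)
qed

lemma epowr_r: "epowr x r = epowr (epowr x p) (r / p)"
  using p by (simp add: epowr_epowr)

lemma \<rho>_powr_\<theta>: "\<rho> k powr (- (\<theta> * p)) = 2 powr (\<theta> * (\<alpha> - \<beta>) * real k)"
proof -
  have "- ((\<alpha> - \<beta>) / p * real k) * - (\<theta> * p) = \<theta> * (\<alpha> - \<beta>) * real k" using p by simp
  then show ?thesis unfolding \<rho>_def powr_powr by (rule arg_cong)
qed

lemma epowr_scaled_K:
  "0 < t \<Longrightarrow> epowr (ennreal (t powr (- \<theta>)) * K f t) p = ennreal (t powr (- (\<theta> * p))) * epowr (K f t) p"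
  by (simp add: epowr_mult epowr_ennreal powr_powr)

lemma coef_le_scaled_K:
  assumes f: "f \<in> borel_measurable M" and t: "t \<in> scale_block k"
  shows "coef f k \<le> ennreal (2 powr (p + 2 + 2 * \<alpha> + \<beta>)) * epowr (ennreal (t powr (- \<theta>)) * K f t) p"
proof -
  have tpos: "0 < t" using t \<rho>_pos[of "Suc k"] by auto
  have "coef f k = ennreal (2 powr (\<theta> * (\<alpha> - \<beta>) * real k)) * (ennreal (2 powr (- (\<alpha> * real k))) * mass f k)"
  proof -
    have "2 powr ((\<theta> * (\<alpha> - \<beta>) - \<alpha>) * real k) = 2 powr (\<theta> * (\<alpha> - \<beta>) * real k) * 2 powr (- (\<alpha> * real k))"
      by (simp add: powr_add[symmetric] algebra_simps)
    then show ?thesis unfolding coef_def by (simp only: ennreal_mult powr_ge_zero mult.assoc)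
  qed
  also have "\<dots> \<le> ennreal (t powr (- (\<theta> * p))) * (ennreal (2 powr (p + 2 + 2 * \<alpha> + \<beta>)) * epowr (K f t) p)"
  proof (rule mult_mono[OF ennreal_leI K_ge_mass[OF f]])
    show "2 powr (\<theta> * (\<alpha> - \<beta>) * real k) \<le> t powr (- (\<theta> * p))"
      unfolding \<rho>_powr_\<theta>[symmetric] using t tpos p \<theta> by (intro powr_mono2') auto
  qed (use t in simp_all)
  also have "\<dots> = ennreal (2 powr (p + 2 + 2 * \<alpha> + \<beta>)) * epowr (ennreal (t powr (- \<theta>)) * K f t) p"
    by (simp add: epowr_scaled_K[OF tpos] mult.left_commute)
  finally show ?thesis .
qed

lemma scaled_K_le_smoothed:
  assumes f: "f \<in> borel_measurable M" and t: "t \<in> scale_block k"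
  shows "epowr (ennreal (t powr (- \<theta>)) * K f t) p \<le> ennreal (2 powr (\<theta> * (\<alpha> - \<beta>)) * (2 powr p * 4)) * smoothed f k"
proof -
  have tpos: "0 < t" using t \<rho>_pos[of "Suc k"] by auto
  have "epowr (ennreal (t powr (- \<theta>)) * K f t) p \<le> ennreal (2 powr (\<theta> * (\<alpha> - \<beta>)) * 2 powr (\<theta> * (\<alpha> - \<beta>) * real k)) * epowr (K f t) p"
    unfolding epowr_scaled_K[OF tpos]
  proof (intro mult_right_mono ennreal_leI)
    have "t powr (- (\<theta> * p)) \<le> \<rho> (Suc k) powr (- (\<theta> * p))"
      using t \<rho>_pos[of "Suc k"] p \<theta> by (intro powr_mono2') auto
    also have "\<dots> = 2 powr (\<theta> * (\<alpha> - \<beta>)) * 2 powr (\<theta> * (\<alpha> - \<beta>) * real k)"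
      unfolding \<rho>_powr_\<theta> powr_add[symmetric] by (simp add: algebra_simps)
    finally show "t powr (- (\<theta> * p)) \<le> 2 powr (\<theta> * (\<alpha> - \<beta>)) * 2 powr (\<theta> * (\<alpha> - \<beta>) * real k)" .
  qed simp
  also have "\<dots> = ennreal (2 powr (\<theta> * (\<alpha> - \<beta>))) * (ennreal (2 powr (\<theta> * (\<alpha> - \<beta>) * real k)) * epowr (K f t) p)"
    by (simp add: ennreal_mult mult.assoc)
  also have "\<dots> \<le> ennreal (2 powr (\<theta> * (\<alpha> - \<beta>))) * (ennreal (2 powr p * 4) * smoothed f k)"
    using t tpos by (intro mult_left_mono K_le_smoothed f) auto
  also have "\<dots> = ennreal (2 powr (\<theta> * (\<alpha> - \<beta>)) * (2 powr p * 4)) * smoothed f k"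
    by (subst ennreal_mult[of "2 powr (\<theta> * (\<alpha> - \<beta>))"]) (auto simp: mult.assoc)
  finally show ?thesis .
qed

lemma dyadic_sum_le_interp_integral:
  obtains C :: real where "0 < C" "\<And>f. f \<in> borel_measurable M \<Longrightarrow> dyadic_sum f \<le> ennreal C * interp_integral f"
proof -
  define c where "c = (2 powr (p + 2 + 2 * \<alpha> + \<beta>)) powr (r / p)"
  define l where "l = (\<alpha> - \<beta>) / p * ln 2"
  have c: "0 < c" by (simp add: c_def)
  have l: "0 < l" using p \<beta>_less_\<alpha> by (simp add: l_def)
  show thesis
  proof (rule that[of "c / l"])
    show "0 < c / l" using c l by simp
    fix f :: "'a \<Rightarrow> real" assume f: "f \<in> borel_measurable M"
    have "(\<Sum>k. (ennreal (1 / c) * epowr (coef f k) (r / p)) * (\<integral>\<^sup>+t\<in>scale_block k. ennreal (1 / t) \<partial>lborel))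
        \<le> (\<integral>\<^sup>+t\<in>(\<Union>k. scale_block k). epowr (ennreal (t powr (- \<theta>)) * K f t) r * ennreal (1 / t) \<partial>lborel)"
    proof (rule nn_integral_UN_ge)
      show "disjoint_family scale_block" by (rule disjoint_intervals_decseq[OF decseq_\<rho>])
      fix k t assume t: "t \<in> scale_block k"
      have "epowr (coef f k) (r / p) \<le> epowr (ennreal (2 powr (p + 2 + 2 * \<alpha> + \<beta>)) * epowr (ennreal (t powr (- \<theta>)) * K f t) p) (r / p)"
        using p r by (intro epowr_mono coef_le_scaled_K f t) auto
      also have "\<dots> = ennreal c * epowr (ennreal (t powr (- \<theta>)) * K f t) r"
        unfolding epowr_r c_def by (simp add: epowr_mult epowr_ennreal)
      finally have "ennreal (1 / c) * epowr (coef f k) (r / p) \<le> ennreal (1 / c) * (ennreal c * epowr (ennreal (t powr (- \<theta>)) * K f t) r)"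
        by (rule mult_left_mono) simp
      also have "\<dots> = epowr (ennreal (t powr (- \<theta>)) * K f t) r"
        using c by (simp add: mult.assoc[symmetric] ennreal_mult[symmetric])
      finally show "ennreal (1 / c) * epowr (coef f k) (r / p) * ennreal (1 / t)
          \<le> epowr (ennreal (t powr (- \<theta>)) * K f t) r * ennreal (1 / t)"
        by (rule mult_right_mono) simp
    qed auto
    then have "(\<Sum>k. ennreal (1 / c) * epowr (coef f k) (r / p) * ennreal l) \<le> interp_integral f"
      unfolding nn_integral_reciprocal_scale_block UN_scale_block interp_integral_def[symmetric] l_def[symmetric] .
    moreover have "ennreal (l / c) * dyadic_sum f \<le> interp_integral f"
      if "(\<Sum>k. ennreal (1 / c) * epowr (coef f k) (r / p) * ennreal l) \<le> interp_integral f"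
    proof -
      have "ennreal (l / c) = ennreal (1 / c) * ennreal l" using c l by (subst ennreal_mult[symmetric]) auto
      then have "ennreal (1 / c) * epowr (coef f k) (r / p) * ennreal l = ennreal (l / c) * epowr (coef f k) (r / p)" for k
        by (simp only: mult_ac)
      with that show ?thesis by (simp add: dyadic_sum_def)
    qed
    ultimately have "ennreal (c / l) * (ennreal (l / c) * dyadic_sum f) \<le> ennreal (c / l) * interp_integral f"
      by (intro mult_left_mono) simp_all
    then show "dyadic_sum f \<le> ennreal (c / l) * interp_integral f"
      using c l by (simp add: mult.assoc[symmetric] ennreal_mult[symmetric])
  qed
qed

lemma interp_integral_le_dyadic_sum:
  obtains C :: real where "0 < C" "\<And>f. f \<in> borel_measurable M \<Longrightarrow> interp_integral f \<le> ennreal C * dyadic_sum f"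
proof -
  define c where "c = (2 powr (\<theta> * (\<alpha> - \<beta>)) * (2 powr p * 4)) powr (r / p)"
  define l where "l = (\<alpha> - \<beta>) / p * ln 2"
  have c: "0 < c" by (simp add: c_def)
  have l: "0 < l" using p \<beta>_less_\<alpha> by (simp add: l_def)
  obtain H where H: "0 < H" "\<And>f. (\<Sum>k. epowr (smoothed f k) (r / p)) \<le> ennreal H * dyadic_sum f"
    using sum_epowr_smoothed_le by blast
  show thesis
  proof (rule that[of "c * l * H"])
    show "0 < c * l * H" using c l H by simp
    fix f :: "'a \<Rightarrow> real" assume f: "f \<in> borel_measurable M"
    have "interp_integral f \<le> (\<Sum>k. (ennreal c * epowr (smoothed f k) (r / p)) * (\<integral>\<^sup>+t\<in>scale_block k. ennreal (1 / t) \<partial>lborel))"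
      unfolding interp_integral_def UN_scale_block[symmetric]
    proof (rule nn_integral_UN_le)
      fix k t assume t: "t \<in> scale_block k"
      have "epowr (ennreal (t powr (- \<theta>)) * K f t) r \<le> epowr (ennreal (2 powr (\<theta> * (\<alpha> - \<beta>)) * (2 powr p * 4)) * smoothed f k) (r / p)"
        unfolding epowr_r using p r by (intro epowr_mono scaled_K_le_smoothed f t) auto
      also have "\<dots> = ennreal c * epowr (smoothed f k) (r / p)"
        unfolding c_def by (subst epowr_mult, subst epowr_ennreal) auto
      finally show "epowr (ennreal (t powr (- \<theta>)) * K f t) r * ennreal (1 / t)
          \<le> ennreal c * epowr (smoothed f k) (r / p) * ennreal (1 / t)"
        by (rule mult_right_mono) simp
    qed auto
    also have "\<dots> = ennreal (c * l) * (\<Sum>k. epowr (smoothed f k) (r / p))"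
      unfolding nn_integral_reciprocal_scale_block l_def[symmetric] ennreal_suminf_cmult[symmetric]
      using c l by (simp add: ennreal_mult mult_ac)
    also have "\<dots> \<le> ennreal (c * l) * (ennreal H * dyadic_sum f)"
      by (intro mult_left_mono H) auto
    also have "\<dots> = ennreal (c * l * H) * dyadic_sum f"
      using c l H by (simp add: ennreal_mult mult.assoc)
    finally show "interp_integral f \<le> ennreal (c * l * H) * dyadic_sum f" .
  qed
qed

section \<open>The Gamma norm is dyadic\<close>

lemma inner_integral_le_smoothed:
  assumes f: "f \<in> borel_measurable M" and t: "t \<in> block k"
  shows "ennreal (2 powr (\<theta> * (\<alpha> - \<beta>) * real k)) * inner_integral f t \<le> smoothed f k"
proof -
  note [measurable] = decr_rearr_measurable[OF fin f]
  have "inner_integral f t \<le> (\<integral>\<^sup>+\<sigma>\<in>{0<..<1}. ennreal (decr_rearr M f \<sigma> powr p * (1 - ln \<sigma>) powr (- \<alpha>)) * indicator {0<..<t} \<sigma> \<partial>lborel)"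
    unfolding inner_integral_def
    using t decseqD[OF decseq_knot, of 0 k] by (intro nn_integral_mono) (auto simp: indicator_def knot_zero)
  also have "\<dots> \<le> (\<Sum>j. ennreal (if k \<le> j then 2 powr (- (\<alpha> * real j)) else 0) * mass f j)"
    unfolding UN_block[symmetric] rearr_mass_def
  proof (rule nn_integral_UN_le)
    fix j \<sigma> assume \<sigma>: "\<sigma> \<in> block j"
    show "ennreal (decr_rearr M f \<sigma> powr p * (1 - ln \<sigma>) powr (- \<alpha>)) * indicator {0<..<t} \<sigma>
      \<le> ennreal (if k \<le> j then 2 powr (- (\<alpha> * real j)) else 0) * ennreal (decr_rearr M f \<sigma> powr p)"
    proof (cases "k \<le> j")
      case True
      have "(1 - ln \<sigma>) powr (- \<alpha>) \<le> 2 powr (- (\<alpha> * real j))"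
        using \<beta> \<beta>_less_\<alpha> by (intro powr_minus_le_dyadic block_log_bounds[OF \<sigma>]) auto
      then have "decr_rearr M f \<sigma> powr p * (1 - ln \<sigma>) powr (- \<alpha>) \<le> decr_rearr M f \<sigma> powr p * 2 powr (- (\<alpha> * real j))"
        by (rule mult_left_mono) simp
      then show ?thesis using True
        by (auto simp: ennreal_mult[symmetric] mult.commute indicator_def intro!: ennreal_leI)
    next
      case False
      then have "t \<le> \<sigma>" using \<sigma> t decseqD[OF decseq_knot, of "Suc j" k] by auto
      then show ?thesis by simp
    qed
  qed auto
  finally have "ennreal (2 powr (\<theta> * (\<alpha> - \<beta>) * real k)) * inner_integral f t
      \<le> ennreal (2 powr (\<theta> * (\<alpha> - \<beta>) * real k)) * (\<Sum>j. ennreal (if k \<le> j then 2 powr (- (\<alpha> * real j)) else 0) * mass f j)"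
    by (rule mult_left_mono) simp
  also have "\<dots> \<le> smoothed f k" by (rule tail_le_smoothed)
  finally show ?thesis .
qed

text \<open>For \<open>t\<close> in block \<open>k\<close> the interval \<open>(0,t)\<close> contains all of block \<open>k + 1\<close>, but possibly nothing of
  block \<open>k\<close>; this is the reason for the shift of the index.\<close>

lemma coef_Suc_le_inner_integral:
  assumes f: "f \<in> borel_measurable M" and t: "t \<in> block k"
  shows "coef f (Suc k) \<le> ennreal (2 powr (\<alpha> + \<theta> * (\<alpha> - \<beta>))) * (ennreal (2 powr (\<theta> * (\<alpha> - \<beta>) * real k)) * inner_integral f t)"
proof -
  note [measurable] = decr_rearr_measurable[OF fin f]
  have "ennreal (2 powr (- (\<alpha> * (real k + 2)))) * mass f (Suc k)
      = (\<integral>\<^sup>+\<sigma>\<in>block (Suc k). ennreal (2 powr (- (\<alpha> * (real k + 2)))) * ennreal (decr_rearr M f \<sigma> powr p) \<partial>lborel)"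
    unfolding rearr_mass_def by (subst nn_integral_cmult[symmetric]) (simp_all add: mult.assoc)
  also have "\<dots> \<le> inner_integral f t"
    unfolding inner_integral_def
  proof (rule nn_integral_mono)
    fix \<sigma> :: real
    show "ennreal (2 powr (- (\<alpha> * (real k + 2)))) * ennreal (decr_rearr M f \<sigma> powr p) * indicator (block (Suc k)) \<sigma>
      \<le> ennreal (decr_rearr M f \<sigma> powr p * (1 - ln \<sigma>) powr (- \<alpha>)) * indicator {0<..<t} \<sigma>"
    proof (cases "\<sigma> \<in> block (Suc k)")
      case True
      note b = block_log_bounds[OF True]
      have "2 powr (- (\<alpha> * (real k + 2))) = (2 ^ Suc (Suc k)) powr (- \<alpha>)"
      proof -
        have "(2::real) ^ Suc (Suc k) = 2 powr (real k + 2)"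
          by (subst powr_realpow[symmetric]) (simp_all add: add.commute)
        moreover have "(real k + 2) * - \<alpha> = - (\<alpha> * (real k + 2))" by (simp add: algebra_simps)
        ultimately show ?thesis by (simp only: powr_powr)
      qed
      also have "\<dots> \<le> (1 - ln \<sigma>) powr (- \<alpha>)"
      proof (rule powr_mono2')
        show "0 < 1 - ln \<sigma>" using b(1) zero_less_power[of "2::real" "Suc k"] by linarith
      qed (use b \<beta> \<beta>_less_\<alpha> in auto)
      finally have "2 powr (- (\<alpha> * (real k + 2))) * decr_rearr M f \<sigma> powr p \<le> (1 - ln \<sigma>) powr (- \<alpha>) * decr_rearr M f \<sigma> powr p"
        by (rule mult_right_mono) simp
      moreover have "\<sigma> \<in> {0<..<t}" using True t b(3) by auto
      ultimately show ?thesis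
        using True by (simp add: ennreal_mult[symmetric] mult.commute ennreal_leI)
    qed simp
  qed
  finally have "ennreal (2 powr (\<alpha> + \<theta> * (\<alpha> - \<beta>)) * 2 powr (\<theta> * (\<alpha> - \<beta>) * real k)) * (ennreal (2 powr (- (\<alpha> * (real k + 2)))) * mass f (Suc k))
      \<le> ennreal (2 powr (\<alpha> + \<theta> * (\<alpha> - \<beta>)) * 2 powr (\<theta> * (\<alpha> - \<beta>) * real k)) * inner_integral f t"
    by (rule mult_left_mono) simp
  moreover have "2 powr (\<alpha> + \<theta> * (\<alpha> - \<beta>)) * 2 powr (\<theta> * (\<alpha> - \<beta>) * real k) * 2 powr (- (\<alpha> * (real k + 2)))
      = 2 powr ((\<theta> * (\<alpha> - \<beta>) - \<alpha>) * real (Suc k))"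
    unfolding powr_add[symmetric] by (simp add: algebra_simps)
  then have "ennreal (2 powr (\<alpha> + \<theta> * (\<alpha> - \<beta>)) * 2 powr (\<theta> * (\<alpha> - \<beta>) * real k)) * (ennreal (2 powr (- (\<alpha> * (real k + 2)))) * mass f (Suc k))
      = coef f (Suc k)"
    unfolding coef_def by (subst mult.assoc[symmetric], subst ennreal_mult[symmetric]) simp_all
  moreover have "ennreal (2 powr (\<alpha> + \<theta> * (\<alpha> - \<beta>)) * 2 powr (\<theta> * (\<alpha> - \<beta>) * real k)) * inner_integral f t
      = ennreal (2 powr (\<alpha> + \<theta> * (\<alpha> - \<beta>))) * (ennreal (2 powr (\<theta> * (\<alpha> - \<beta>) * real k)) * inner_integral f t)"
    by (simp add: ennreal_mult mult.assoc)
  ultimately show ?thesis by (simp only:)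
qed

lemma coef_0_le: 
  obtains C :: real where "0 < C" "\<And>f. f \<in> borel_measurable M \<Longrightarrow> coef f 0 \<le> ennreal C * coef f 1"
proof (rule that[of "2 / knot 1 * 2 powr (- (\<theta> * (\<alpha> - \<beta>) - \<alpha>))"])
  show "0 < 2 / knot 1 * 2 powr (- (\<theta> * (\<alpha> - \<beta>) - \<alpha>))" using knot_pos[of 1] by simp
  fix f :: "'a \<Rightarrow> real" assume f: "f \<in> borel_measurable M"
  have "coef f 0 \<le> ennreal (2 / knot 1) * mass f 1"
    using rearr_mass_0_le[OF fin f p] by (simp add: coef_def)
  also have "ennreal (2 / knot 1) = ennreal (2 / knot 1 * 2 powr (- (\<theta> * (\<alpha> - \<beta>) - \<alpha>))) * ennreal (2 powr ((\<theta> * (\<alpha> - \<beta>) - \<alpha>) * real 1))"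
    using knot_pos[of 1] by (subst ennreal_mult[symmetric]) (simp_all add: mult.assoc powr_add[symmetric])
  finally show "coef f 0 \<le> ennreal (2 / knot 1 * 2 powr (- (\<theta> * (\<alpha> - \<beta>) - \<alpha>))) * coef f 1"
    by (simp only: coef_def mult.assoc)
qed

definition weight_exp :: real where
  "weight_exp = r * \<theta> / p * (\<alpha> - \<beta>) - 1"

definition gamma_integrand :: "('a \<Rightarrow> real) \<Rightarrow> real \<Rightarrow> ennreal" where
  "gamma_integrand f t = ennreal (t powr (- 1) * (1 - ln t) powr weight_exp) * epowr (inner_integral f t) (r / p)"

text \<open>The exponent of the logarithm in the outer weight is such that its value at \<open>2 ^ k\<close> is the
  \<open>(r / p)\<close>-th power of \<open>2 powr (\<theta> * (\<alpha> - \<beta>) * k)\<close>, divided by \<open>2 ^ k\<close>. The latter factor compensates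
  the \<open>dt / t\<close>-length of the block.\<close>

lemma gamma_integrand_bounds:
  fixes f :: "'a \<Rightarrow> real"
  assumes t: "t \<in> block k"
  defines "V \<equiv> epowr (ennreal (2 powr (\<theta> * (\<alpha> - \<beta>) * real k)) * inner_integral f t) (r / p)"
  shows "ennreal (2 powr (- \<bar>weight_exp\<bar>) / 2 ^ k) * V * ennreal (1 / t) \<le> gamma_integrand f t"
    and "gamma_integrand f t \<le> ennreal (2 powr \<bar>weight_exp\<bar> / 2 ^ k) * V * ennreal (1 / t)"
proof -
  note b = block_log_bounds[OF t]
  define W where "W = (2 powr (\<theta> * (\<alpha> - \<beta>) * real k)) powr (r / p)"
  have W: "0 < W" by (simp add: W_def)
  have pow: "(2 ^ k) powr weight_exp = W / 2 ^ k"
  proof -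
    have "(2 ^ k) powr weight_exp = 2 powr (real k * weight_exp)"
      by (simp add: powr_powr flip: powr_realpow)
    also have "real k * weight_exp = \<theta> * (\<alpha> - \<beta>) * real k * (r / p) - real k"
      by (simp add: weight_exp_def algebra_simps diff_divide_distrib)
    also have "2 powr \<dots> = W / 2 ^ k"
      by (simp add: W_def powr_powr powr_diff powr_realpow)
    finally show ?thesis .
  qed
  have V: "V = ennreal W * epowr (inner_integral f t) (r / p)"
    by (simp add: V_def W_def epowr_mult epowr_ennreal)
  have regroup: "ennreal (c / 2 ^ k) * V * ennreal (1 / t) = ennreal (1 / t * (c * (2 ^ k) powr weight_exp)) * epowr (inner_integral f t) (r / p)"
    if "0 \<le> c" for c
  proof -
    have "ennreal (1 / t * (c * (2 ^ k) powr weight_exp)) = ennreal (c / 2 ^ k) * ennreal W * ennreal (1 / t)"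
      unfolding pow using that b(3) W by (simp add: ennreal_mult[symmetric] mult.commute)
    then show ?thesis unfolding V by (simp only: mult_ac)
  qed
  have inv: "t powr (- 1) = 1 / t" using b(3) by (simp add: powr_minus_divide)
  note pb = powr_dyadic_bounds[of "2 ^ k" "1 - ln t" weight_exp]
  have "2 powr (- \<bar>weight_exp\<bar>) * (2 ^ k) powr weight_exp \<le> (1 - ln t) powr weight_exp"
    using b by (intro pb) auto
  then show "ennreal (2 powr (- \<bar>weight_exp\<bar>) / 2 ^ k) * V * ennreal (1 / t) \<le> gamma_integrand f t"
    unfolding gamma_integrand_def inv using b(3)
    by (subst regroup) (auto intro!: mult_right_mono ennreal_leI divide_right_mono)
  have "(1 - ln t) powr weight_exp \<le> 2 powr \<bar>weight_exp\<bar> * (2 ^ k) powr weight_exp"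
    using b by (intro pb) auto
  then show "gamma_integrand f t \<le> ennreal (2 powr \<bar>weight_exp\<bar> / 2 ^ k) * V * ennreal (1 / t)"
    unfolding gamma_integrand_def inv using b(3)
    by (subst regroup) (auto intro!: mult_right_mono ennreal_leI divide_right_mono)
qed

lemma gamma_integral_eq: "gamma_integral f = (\<integral>\<^sup>+t\<in>(\<Union>k. block k). gamma_integrand f t \<partial>lborel)"
  unfolding UN_block gamma_integral_def gamma_integrand_def weight_exp_def ..

lemma gamma_integral_le_dyadic_sum:
  obtains C :: real where "0 < C" "\<And>f. f \<in> borel_measurable M \<Longrightarrow> gamma_integral f \<le> ennreal C * dyadic_sum f"
proof -
  define c where "c = 2 powr \<bar>weight_exp\<bar>"
  have c: "0 < c" by (simp add: c_def)
  obtain H where H: "0 < H" "\<And>f. (\<Sum>k. epowr (smoothed f k) (r / p)) \<le> ennreal H * dyadic_sum f"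
    using sum_epowr_smoothed_le by blast
  show thesis
  proof (rule that[of "c * H"])
    show "0 < c * H" using c H by simp
    fix f :: "'a \<Rightarrow> real" assume f: "f \<in> borel_measurable M"
    have "gamma_integral f \<le> (\<Sum>k. (ennreal (c / 2 ^ k) * epowr (smoothed f k) (r / p)) * (\<integral>\<^sup>+t\<in>block k. ennreal (1 / t) \<partial>lborel))"
      unfolding gamma_integral_eq
    proof (rule nn_integral_UN_le)
      fix k t assume t: "t \<in> block k"
      show "gamma_integrand f t \<le> ennreal (c / 2 ^ k) * epowr (smoothed f k) (r / p) * ennreal (1 / t)"
        unfolding c_def using p r
        by (intro order_trans[OF gamma_integrand_bounds(2)[OF t]] mult_right_mono mult_left_mono epowr_mono
            inner_integral_le_smoothed f t) auto
    qed auto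
    also have "\<dots> = (\<Sum>k. ennreal c * epowr (smoothed f k) (r / p))"
    proof -
      have "ennreal (c / 2 ^ k) * ennreal (2 ^ k) = ennreal c" for k
        using c by (subst ennreal_mult[symmetric]) auto
      then have "ennreal (c / 2 ^ k) * epowr (smoothed f k) (r / p) * ennreal (2 ^ k) = ennreal c * epowr (smoothed f k) (r / p)" for k
        by (metis mult.assoc mult.commute)
      then show ?thesis unfolding nn_integral_reciprocal_block by (simp only:)
    qed
    also have "\<dots> \<le> ennreal c * (ennreal H * dyadic_sum f)"
      unfolding ennreal_suminf_cmult by (intro mult_left_mono H) auto
    also have "\<dots> = ennreal (c * H) * dyadic_sum f"
      using c H by (simp add: ennreal_mult mult.assoc)
    finally show "gamma_integral f \<le> ennreal (c * H) * dyadic_sum f" .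
  qed
qed

lemma dyadic_sum_le_gamma_integral:
  obtains C :: real where "0 < C" "\<And>f. f \<in> borel_measurable M \<Longrightarrow> dyadic_sum f \<le> ennreal C * gamma_integral f"
proof -
  define c where "c = 2 powr (- \<bar>weight_exp\<bar>)"
  define d where "d = (2 powr (\<alpha> + \<theta> * (\<alpha> - \<beta>))) powr (r / p)"
  have c: "0 < c" and d: "0 < d" by (simp_all add: c_def d_def)
  obtain A where A: "0 < A" "\<And>f. f \<in> borel_measurable M \<Longrightarrow> coef f 0 \<le> ennreal A * coef f 1"
    using coef_0_le by blast
  show thesis
  proof (rule that[of "(A powr (r / p) + 1) * (d / c)"])
    show "0 < (A powr (r / p) + 1) * (d / c)" using A c d by (simp add: add_pos_pos)
    fix f :: "'a \<Rightarrow> real" assume f: "f \<in> borel_measurable M"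
    let ?u = "\<lambda>k. epowr (coef f k) (r / p)"
    define T where "T = (\<Sum>k. ?u (Suc k))"
    have "(\<Sum>k. (ennreal (c / d / 2 ^ k) * ?u (Suc k)) * (\<integral>\<^sup>+t\<in>block k. ennreal (1 / t) \<partial>lborel)) \<le> gamma_integral f"
      unfolding gamma_integral_eq
    proof (rule nn_integral_UN_ge[OF disjoint_block])
      fix k t assume t: "t \<in> block k"
      let ?V = "epowr (ennreal (2 powr (\<theta> * (\<alpha> - \<beta>) * real k)) * inner_integral f t) (r / p)"
      have "?u (Suc k) \<le> epowr (ennreal (2 powr (\<alpha> + \<theta> * (\<alpha> - \<beta>))) * (ennreal (2 powr (\<theta> * (\<alpha> - \<beta>) * real k)) * inner_integral f t)) (r / p)"
        using p r by (intro epowr_mono coef_Suc_le_inner_integral f t) auto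
      also have "\<dots> = ennreal d * ?V"
        unfolding d_def by (subst epowr_mult, subst epowr_ennreal) auto
      finally have "ennreal (c / d / 2 ^ k) * ?u (Suc k) \<le> ennreal (c / d / 2 ^ k) * (ennreal d * ?V)"
        by (rule mult_left_mono) simp
      also have "\<dots> = ennreal (c / d / 2 ^ k) * ennreal d * ?V"
        by (rule mult.assoc[symmetric])
      also have "ennreal (c / d / 2 ^ k) * ennreal d = ennreal (c / 2 ^ k)"
        using c d by (subst ennreal_mult[symmetric]) auto
      finally have "ennreal (c / d / 2 ^ k) * ?u (Suc k) * ennreal (1 / t) \<le> ennreal (c / 2 ^ k) * ?V * ennreal (1 / t)"
        by (rule mult_right_mono) simp
      also have "\<dots> \<le> gamma_integrand f t"
        unfolding c_def by (rule gamma_integrand_bounds(1)[OF t])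
      finally show "ennreal (c / d / 2 ^ k) * ?u (Suc k) * ennreal (1 / t) \<le> gamma_integrand f t" .
    qed auto
    also have "(\<Sum>k. (ennreal (c / d / 2 ^ k) * ?u (Suc k)) * (\<integral>\<^sup>+t\<in>block k. ennreal (1 / t) \<partial>lborel)) = ennreal (c / d) * T"
    proof -
      have "ennreal (c / d / 2 ^ k) * ennreal (2 ^ k) = ennreal (c / d)" for k
        using c d by (subst ennreal_mult[symmetric]) auto
      then have "ennreal (c / d / 2 ^ k) * ?u (Suc k) * ennreal (2 ^ k) = ennreal (c / d) * ?u (Suc k)" for k
        by (metis mult.assoc mult.commute)
      then show ?thesis unfolding nn_integral_reciprocal_block T_def by simp
    qed
    finally have "ennreal (d / c) * (ennreal (c / d) * T) \<le> ennreal (d / c) * gamma_integral f"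
      by (rule mult_left_mono) simp
    then have T: "T \<le> ennreal (d / c) * gamma_integral f"
      using c d by (simp add: mult.assoc[symmetric] ennreal_mult[symmetric])
    \<comment> \<open>The first term is bounded by the next one, so the shifted sum suffices.\<close>
    have "dyadic_sum f = ?u 0 + T"
      using suminf_offset[of ?u 1] by (simp add: dyadic_sum_def T_def add.commute)
    also have "?u 0 \<le> epowr (ennreal A * coef f 1) (r / p)"
      using p r by (intro epowr_mono A f) auto
    also have "\<dots> = ennreal (A powr (r / p)) * ?u (Suc 0)"
      using A by (simp add: epowr_mult epowr_ennreal)
    also have "\<dots> \<le> ennreal (A powr (r / p)) * T"
      unfolding T_def by (intro mult_left_mono term_le_suminf_ennreal[of "\<lambda>k. ?u (Suc k)"]) auto
    also have "ennreal (A powr (r / p)) * T + T = ennreal (A powr (r / p) + 1) * T"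
      by (simp add: ennreal_plus distrib_right)
    also have "\<dots> \<le> ennreal (A powr (r / p) + 1) * (ennreal (d / c) * gamma_integral f)"
      by (intro mult_left_mono T) auto
    also have "\<dots> = ennreal ((A powr (r / p) + 1) * (d / c)) * gamma_integral f"
      using c d by (subst ennreal_mult) (auto simp: mult.assoc)
    finally show "dyadic_sum f \<le> ennreal ((A powr (r / p) + 1) * (d / c)) * gamma_integral f"
      by (simp add: add_right_mono)
  qed
qed

section \<open>Equality of the spaces\<close>

text \<open>If \<open>f\<close> had no decomposition, its K-functional would be an infimum over the empty set, that is
  infinite for every \<open>t\<close>.\<close>

lemma sum_elts_if_interp_integral_finite:
  assumes f: "f \<in> borel_measurable M" and fin_int: "interp_integral f < top"
  shows "f \<in> sum_elts M (grand_Lebesgue M p \<alpha>) (grand_Lebesgue M p \<beta>)"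
proof (rule ccontr)
  assume "f \<notin> sum_elts M (grand_Lebesgue M p \<alpha>) (grand_Lebesgue M p \<beta>)"
  then have "decomps M (grand_Lebesgue M p \<alpha>) (grand_Lebesgue M p \<beta>) f = {}"
    using f by (simp add: sum_elts_def)
  then have K: "K f t = top" for t by (simp add: K_functional_def)
  have "interp_integral f = (\<integral>\<^sup>+t\<in>{0<..<1::real}. top \<partial>lborel)"
    unfolding interp_integral_def K
    by (intro nn_integral_cong) (auto simp: indicator_def ennreal_mult_top epowr_top ennreal_top_mult)
  also have "\<dots> = top" by (subst nn_integral_cmult_indicator) (auto simp: ennreal_top_mult)
  finally show False using fin_int by simp
qed

lemma real_interp_grand_Lebesgue:
  "equal_spaces
    (real_interp M (grand_Lebesgue M p \<alpha>) (grand_Lebesgue M p \<beta>) \<theta> r)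
    (GGamma M p r
       (\<lambda>t. t powr (- 1) * (1 - ln t) powr (r * \<theta> / p * (\<alpha> - \<beta>) - 1))
       (\<lambda>t. (1 - ln t) powr (- \<alpha>)))"
  (is "equal_spaces (real_interp M ?X0 ?X1 \<theta> r) (GGamma M p r ?w1 ?w2)")
proof -
  obtain A where A: "0 < A" "\<And>f. f \<in> borel_measurable M \<Longrightarrow> interp_integral f \<le> ennreal A * dyadic_sum f"
    using interp_integral_le_dyadic_sum by blast
  obtain B where B: "0 < B" "\<And>f. f \<in> borel_measurable M \<Longrightarrow> dyadic_sum f \<le> ennreal B * interp_integral f"
    using dyadic_sum_le_interp_integral by blast
  obtain C where C: "0 < C" "\<And>f. f \<in> borel_measurable M \<Longrightarrow> gamma_integral f \<le> ennreal C * dyadic_sum f"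
    using gamma_integral_le_dyadic_sum by blast
  obtain D where D: "0 < D" "\<And>f. f \<in> borel_measurable M \<Longrightarrow> dyadic_sum f \<le> ennreal D * gamma_integral f"
    using dyadic_sum_le_gamma_integral by blast
  have interp_le: "interp_integral f \<le> ennreal (A * D) * gamma_integral f" if f: "f \<in> borel_measurable M" for f
  proof -
    have "interp_integral f \<le> ennreal A * (ennreal D * gamma_integral f)"
      by (intro order_trans[OF A(2)[OF f]] mult_left_mono D f) simp
    then show ?thesis using A(1) D(1) by (simp add: ennreal_mult mult.assoc)
  qed
  have gamma_le: "gamma_integral f \<le> ennreal (C * B) * interp_integral f" if f: "f \<in> borel_measurable M" for f
  proof -
    have "gamma_integral f \<le> ennreal C * (ennreal B * interp_integral f)"
      by (intro order_trans[OF C(2)[OF f]] mult_left_mono B f) simp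
    then show ?thesis using B(1) C(1) by (simp add: ennreal_mult mult.assoc)
  qed
  define w1 where "w1 = ?w1"
  define w2 where "w2 = ?w2"
  have X: "interp_norm M ?X0 ?X1 \<theta> r f = epowr (interp_integral f) (1 / r)" for f
    by (simp add: interp_norm_def interp_integral_def)
  have Y: "ggamma_norm M p r w1 w2 f = epowr (gamma_integral f) (1 / r)" for f
    by (simp add: ggamma_norm_def gamma_integral_def inner_integral_def w1_def w2_def)
  have finite_iff: "interp_integral f < top \<longleftrightarrow> gamma_integral f < top" if f: "f \<in> borel_measurable M" for f
    using le_less_trans[OF interp_le[OF f]] le_less_trans[OF gamma_le[OF f]] by (auto simp: ennreal_mult_less_top)
  have elts: "elts (real_interp M ?X0 ?X1 \<theta> r) = elts (GGamma M p r w1 w2)"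
  proof (intro equalityI subsetI)
    fix f assume "f \<in> elts (real_interp M ?X0 ?X1 \<theta> r)"
    then show "f \<in> elts (GGamma M p r w1 w2)"
      using finite_iff[of f] by (simp add: real_interp_def GGamma_def fun_space_of_def sum_elts_def X Y epowr_less_top_iff)
  next
    fix f assume "f \<in> elts (GGamma M p r w1 w2)"
    then have "f \<in> borel_measurable M" "interp_integral f < top"
      using finite_iff[of f] by (simp_all add: GGamma_def fun_space_of_def Y epowr_less_top_iff)
    then show "f \<in> elts (real_interp M ?X0 ?X1 \<theta> r)"
      using sum_elts_if_interp_integral_finite by (simp add: real_interp_def X epowr_less_top_iff)
  qed
  define a where "a = (A * D) powr (1 / r)"
  define b where "b = (C * B) powr (1 / r)"
  have a: "0 < a" and b: "0 < b" using A(1) B(1) C(1) D(1) by (auto simp: a_def b_def)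
  have "ennreal (1 / a) * interp_norm M ?X0 ?X1 \<theta> r f \<le> ggamma_norm M p r w1 w2 f
      \<and> ggamma_norm M p r w1 w2 f \<le> ennreal b * interp_norm M ?X0 ?X1 \<theta> r f"
    if f: "f \<in> borel_measurable M" for f
  proof
    have "epowr (interp_integral f) (1 / r) \<le> epowr (ennreal (A * D) * gamma_integral f) (1 / r)"
      using r by (intro epowr_mono interp_le f) auto
    also have "\<dots> = ennreal a * epowr (gamma_integral f) (1 / r)"
      unfolding a_def using A(1) D(1) by (subst epowr_mult, subst epowr_ennreal) auto
    finally have "ennreal (1 / a) * epowr (interp_integral f) (1 / r) \<le> ennreal (1 / a) * (ennreal a * epowr (gamma_integral f) (1 / r))"
      by (rule mult_left_mono) simp
    then show "ennreal (1 / a) * interp_norm M ?X0 ?X1 \<theta> r f \<le> ggamma_norm M p r w1 w2 f"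
      unfolding X Y using a by (simp add: mult.assoc[symmetric] ennreal_mult[symmetric])
    have "epowr (gamma_integral f) (1 / r) \<le> epowr (ennreal (C * B) * interp_integral f) (1 / r)"
      using r by (intro epowr_mono gamma_le f) auto
    also have "\<dots> = ennreal b * epowr (interp_integral f) (1 / r)"
      unfolding b_def using C(1) B(1) by (subst epowr_mult, subst epowr_ennreal) auto
    finally show "ggamma_norm M p r w1 w2 f \<le> ennreal b * interp_norm M ?X0 ?X1 \<theta> r f"
      unfolding X Y .
  qed
  moreover have "f \<in> borel_measurable M" if "f \<in> elts (real_interp M ?X0 ?X1 \<theta> r)" for f
    using that by (simp add: real_interp_def sum_elts_def)
  ultimately have "\<forall>f\<in>elts (real_interp M ?X0 ?X1 \<theta> r).
      ennreal (1 / a) * qnorm (real_interp M ?X0 ?X1 \<theta> r) f \<le> qnorm (GGamma M p r w1 w2) f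
      \<and> qnorm (GGamma M p r w1 w2) f \<le> ennreal b * qnorm (real_interp M ?X0 ?X1 \<theta> r) f"
    by (simp add: real_interp_def GGamma_def fun_space_of_def)
  moreover have "0 < 1 / a" using a by simp
  ultimately show ?thesis
    unfolding w1_def[symmetric] w2_def[symmetric] equal_spaces_def using elts b by blast
qed

end

theorem theorem3p6:
  fixes \<Omega> :: "(real ^ 'n) set" and p \<alpha> \<beta> \<theta> r :: real
  assumes "open \<Omega>" and "bounded \<Omega>" and "emeasure lebesgue \<Omega> = 1"
    and "1 < p" and "0 < \<beta>" and "\<beta> < \<alpha>" and "0 < \<theta>" and "\<theta> < 1" and "1 \<le> r"
  shows "equal_spaces
    (real_interp (lebesgue_on \<Omega>)
       (grand_Lebesgue (lebesgue_on \<Omega>) p \<alpha>) (grand_Lebesgue (lebesgue_on \<Omega>) p \<beta>) \<theta> r)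
    (GGamma (lebesgue_on \<Omega>) p r
       (\<lambda>t. t powr (- 1) * (1 - ln t) powr (r * \<theta> / p * (\<alpha> - \<beta>) - 1))
       (\<lambda>t. (1 - ln t) powr (- \<alpha>)))"
proof -
  have "finite_measure (lebesgue_on \<Omega>)"
    using assms(1,3) by (intro finite_measureI) (simp add: emeasure_restrict_space)
  then interpret grand_couple "lebesgue_on \<Omega>" p \<alpha> \<beta> \<theta> r
    using assms by (simp add: grand_couple_def grand_couple_axioms_def)
  show ?thesis by (rule real_interp_grand_Lebesgue)
qed

end
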